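(* Assume (A1)-(A6) (see context) hold on the local region $(\Omega,V)$, where $V\subset\mathbb{R}^{N\times d}$ is an open ball centred at $Y^*$, and that the iterates satisfy $\theta_k\in\Omega$ for all $k\ge0$ almost surely. Suppose $F$ is convex on $V$, where $Y^*$ is a minimum point of $F$. Let $$\mu=\sqrt{1-\tfrac{b}{N}}\in(0,1),\quad c_2=\tfrac12(LB_1^2+B_0B_2)B_1^2,\quad c_4=4B_1^2L(1+B_1^2L),\quad \nu=\frac{\mu}{1-c_4\eta},$$ $$c_5=4c_2+\frac{b}{2N}B_1^4+\frac{2b\,B_1^4B_3^2}{N\mu(1-\mu)(1-\nu)}.$$ If the fixed step size $\eta>0$ satisfies $$\eta<\min\left\{\frac{1}{c_4}\cdot\frac{b}{2N},\ \frac{\sqrt{2\mu(1-\mu)}\,b}{8B_1^2B_3(2N-b)},\ 1,\ \frac{b}{c_5N}\lambda_{\min}\right\},$$ then there exists a constant $C>0$ such that for all $k\ge1$ $$\mathbb{E}[F(Y(\theta_k))]-F(Y^* )\le\frac{C}{k},$$ where the expectation is over the batches $\mathcal B_0,\dots,\mathcal B_{k-1}$.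
   Context: Setting. $N,d,s\ge1$ are integers; $Y:\mathbb{R}^s\to\mathbb{R}^{N\times d}$ is $C^2$ (its $n$-th row $Y_n(\theta)$ is the output on sample $n$) and $F:\mathbb{R}^{N\times d}\to\mathbb{R}$ is $C^1$. $\nabla_YF(Y)\in\mathbb{R}^{N\times d}$ is the gradient. $\nabla_\theta Y_n(\theta)\in\mathbb{R}^{d\times s}$ is the Jacobian of $Y_n$, and $\nabla_\theta Y(\theta)\in\mathbb{R}^{Nd\times s}$ is the vertical concatenation of the $\nabla_\theta Y_n(\theta)$. $\nabla_\theta^2Y$ is the tensor of second derivatives. $\|\cdot\|_{\mathrm F}$ is the Frobenius norm (Euclidean norm of all entries). Surrogate output-gradient. $\widetilde{\nabla_YF}:\mathbb{R}^{N\times d}\times\mathbb{R}^{N\times d}\to\mathbb{R}^{N\times d}$, $(\tilde Y,Y)\mapsto\widetilde{\nabla_YF}(\tilde Y,Y)$, is $C^1$ in its first argument and satisfies $\widetilde{\nabla_YF}(Y,Y)=\nabla_YF(Y)$. For fixed $Y$, $\mathcal T(\Theta)$ denotes the derivative of $\tilde Y\mapsto\widetilde{\nabla_YF}(\tilde Y,Y)$ at $\tilde Y=\Theta$, a linear map $\Delta\mapsto\mathcal T(\Theta)[\Delta]$ on $\mathbb{R}^{N\times d}$. Algorithm (cached surrogate gradient). Start from a deterministic $\theta_0\in\mathbb{R}^s$ and cache $\tilde Y(\theta_0)=Y(\theta_0)$. At each step $k$ a random batch $\mathcal B_k\subset\{1,\dots,N\}$ of fixed size $b=|\mathcal B_k|$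 (with $1\le b<N$) is drawn, independently of the past, with every index belonging to $\mathcal B_k$ with probability $b/N$. Set $H_k=\sum_{n\in\mathcal B_k}\big(\widetilde{\nabla_YF}(\tilde Y(\theta_k),Y(\theta_k))\big)_n\nabla_\theta Y_n(\theta_k)\in\mathbb{R}^{1\times s}$ (subscript $n$: $n$-th row), $\theta_{k+1}=\theta_k-\eta H_k^\top$ with fixed step size $\eta>0$, and update the cache by rows: $\tilde Y(\theta_{k+1})_n=Y_n(\theta_{k+1})$ if $n\in\mathcal B_k$, and $\tilde Y(\theta_{k+1})_n=\tilde Y(\theta_k)_n$ if $n\notin\mathcal B_k$. Local region and assumptions. $\Omega\subset\mathbb{R}^s$ is an open convex set and $V\subset\mathbb{R}^{N\times d}$ is a convex set with $Y(\Omega)\subset V$. There are positive constants $B_0,L,B_1,B_2,\lambda_{\min},B_3$ such that: (A1) $\|\nabla_YF(Y)\|_{\mathrm F}\le B_0$ for $Y\in V$; (A2) $\|\nabla_YF(Y)-\nabla_YF(Y')\|_{\mathrm F}\le L\|Y-Y'\|_{\mathrm F}$ for $Y,Y'\in V$; (A3) $\|\nabla_\theta Y(\theta)\|_{\mathrm F}\le B_1$ for $\theta\in\Omega$; (A4) $\|\nabla_\theta^2Y(\theta)\|_{\mathrm F}\le B_2$ for $\theta\in\Omega$; (A5) the smallest eigenvalue of $\nabla_\theta Y(\theta)\nabla_\theta Y(\theta)^\top\in\mathbb{R}^{Nd\times Nd}$ is at least $\lambda_{\min}>0$ for $\theta\in\Omega$; (A6) $\|\mathcal T(\Theta)[\Delta]\|_{\mathrm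 F}\le B_3\|\Delta\|_{\mathrm F}$ for all $\Delta\in\mathbb{R}^{N\times d}$ and all relevant $\Theta$, i.e. (almost surely, for every $k$, with $Y=Y(\theta_k)$) all $\Theta=Y(\theta_k)+t(\tilde Y(\theta_k)-Y(\theta_k))$, $t\in[0,1]$. *)

theory Defs
  imports "HOL-Probability.Probability"
begin

text \<open>An \<open>N\<close> by \<open>d\<close> matrix is an element of \<open>real^'d^'n\<close> with \<open>N = CARD('n)\<close> and
  \<open>d = CARD('d)\<close>; samples are indexed by the elements of \<open>'n\<close>.  The library norm on iterated
  finite Cartesian products is the Euclidean norm of all entries, so \<open>norm\<close> is the Frobenius norm
  of matrices and of the second-derivative tensor below, and the inner product is the entrywise
  one.\<close>

definition C1 :: "('a::real_normed_vector \<Rightarrow> 'b::real_normed_vector) \<Rightarrow> bool" where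
  "C1 f \<longleftrightarrow> (\<exists>f'. (\<forall>x. (f has_derivative blinfun_apply (f' x)) (at x)) \<and> continuous_on UNIV f')"

definition C2 :: "('a::real_normed_vector \<Rightarrow> 'b::real_normed_vector) \<Rightarrow> bool" where
  "C2 f \<longleftrightarrow> (\<exists>f'. (\<forall>x. (f has_derivative blinfun_apply (f' x)) (at x)) \<and> C1 f')"

definition grad :: "('a::real_inner \<Rightarrow> real) \<Rightarrow> 'a \<Rightarrow> 'a" where
  "grad f x = (THE g. GDERIV f x :> g)"

definition row_jacobian :: "(real^'s \<Rightarrow> real^'d^'n) \<Rightarrow> 'n \<Rightarrow> real^'s \<Rightarrow> real^'s^'d" where
  "row_jacobian Y n \<theta> = jacobian (\<lambda>\<phi>. Y \<phi> $ n) (at \<theta>)"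

text \<open>The rows of the vertical concatenation are indexed by pairs (sample, output coordinate).\<close>

definition full_jacobian :: "(real^'s \<Rightarrow> real^'d^'n) \<Rightarrow> real^'s \<Rightarrow> real^'s^('n \<times> 'd)" where
  "full_jacobian Y \<theta> = (\<chi> p. row_jacobian Y (fst p) \<theta> $ snd p)"

text \<open>Entry \<open>n, c, i, j\<close> is the second partial derivative of \<open>Y\<^sub>n\<^sub>,\<^sub>c\<close> in the coordinates \<open>i\<close> and \<open>j\<close>.\<close>

definition second_deriv :: "(real^'s \<Rightarrow> real^'d^'n) \<Rightarrow> real^'s \<Rightarrow> real^'s^'s^'d^'n" where
  "second_deriv Y \<theta> = (\<chi> n c. jacobian (\<lambda>\<phi>. row_jacobian Y n \<phi> $ c) (at \<theta>))"

definition eigenvalues :: "real^'m^'m \<Rightarrow> real set" where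
  "eigenvalues A = {l. \<exists>v. v \<noteq> 0 \<and> A *v v = l *\<^sub>R v}"

text \<open>Only used for symmetric matrices, whose set of real eigenvalues is finite and nonempty.\<close>

definition smallest_eigenvalue :: "real^'m^'m \<Rightarrow> real" where
  "smallest_eigenvalue A = Min (eigenvalues A)"

text \<open>The derivative of the surrogate in its first argument, at \<open>\<Theta>\<close>, for fixed second argument.\<close>

definition surrogate_deriv ::
  "(real^'d^'n \<Rightarrow> real^'d^'n \<Rightarrow> real^'d^'n) \<Rightarrow> real^'d^'n \<Rightarrow> real^'d^'n \<Rightarrow> real^'d^'n \<Rightarrow> real^'d^'n" where
  "surrogate_deriv G Z \<Theta> = frechet_derivative (\<lambda>W. G W Z) (at \<Theta>)"

definition batch_gradient ::
  "(real^'s \<Rightarrow> real^'d^'n) \<Rightarrow> (real^'d^'n \<Rightarrow> real^'d^'n \<Rightarrow> real^'d^'n)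
    \<Rightarrow> 'n set \<Rightarrow> real^'d^'n \<Rightarrow> real^'s \<Rightarrow> real^'s" where
  "batch_gradient Y G S Z \<theta> = (\<Sum>n\<in>S. (G Z (Y \<theta>) $ n) v* row_jacobian Y n \<theta>)"

end

(* With g the output gradient at Y(theta_k), e the cache error and h the surrogate gradient, the
   batch gradient is the pullback of the sampled rows of h, and |h - g| <= B3 |e|. The decrease of
   F and the new cache error are both bounded by expressions affine in the indicators of the
   sampled rows, so that, as the batch is independent of the past, only the inclusion probability
   b/N enters the expectation. The Lyapunov function W_k = E[F(Y) - F(Ystar)] + kappa E|e|^2 then
   satisfies W_{k+1} <= W_k - c E|g|^2 - c' E|e|^2. Convexity gives F(Y) - F(Ystar) <= r |g|, and
   E|e|^2 is bounded as W_k decreases; hence W_{k+1} <= W_k - p W_k^2, which forces W_k <= 1/(p k). *)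
theory Submission
  imports Defs
begin

text \<open>\<open>F\<close> composed with \<open>Y\<close> need not be convex in
  \<open>\<theta>\<close>, so the estimates are made in output space: by (A5), moving along the
  pullback of the output gradient \<open>g\<close> gains at least a multiple \<open>lmin\<close> of
  \<open>|g|^2\<close>, a quantity that convexity of \<open>F\<close> can use. A gap linear in
  \<open>|g|\<close> against a gain quadratic in \<open>|g|\<close> makes the rate 1/k rather than
  geometric. The obstacle is a feedback loop: a stale cache perturbs the step, and the step makes
  unsampled cache rows drift. A row stays stale with probability \<open>1 - b/N = \<mu>^2\<close>;
  splitting the new error into old error and drift with weights \<open>1/\<mu>\<close> and
  \<open>1/(1-\<mu>)\<close> leaves a contraction by \<open>\<mu>\<close>. The weight
  \<open>\<kappa>\<close>, of size \<open>(b/N) B3^2 / (1-\<mu>)\<close>, pays for the perturbation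
  of the step, and the drift cost that it brings is dominated by the last term of \<open>c5\<close>.
  The bound on \<open>\<eta>\<close> with \<open>c4\<close> gives \<open>\<nu> < 1\<close>, the one
  with \<open>B3\<close> keeps \<open>c'\<close> positive, the one with \<open>c5\<close> keeps
  \<open>c\<close> positive.\<close>

section \<open>Matrix norms and the smallest eigenvalue of a symmetric matrix\<close>

lemma norm_matrix_vector_le:
  fixes A :: "real^'m^'k"
  shows "norm (A *v x) \<le> norm A * norm x"
proof -
  have "(norm (A *v x))\<^sup>2 = (\<Sum>i\<in>UNIV. ((A $ i) \<bullet> x)\<^sup>2)"
    unfolding power2_norm_eq_inner inner_vec_def[of "A *v x"] matrix_vector_mul_component
    by (simp add: power2_eq_square)
  also have "\<dots> \<le> (\<Sum>i\<in>UNIV. (norm (A $ i))\<^sup>2 * (norm x)\<^sup>2)"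
    by (intro sum_mono) (metis Cauchy_Schwarz_ineq power2_norm_eq_inner)
  also have "\<dots> = (norm A * norm x)\<^sup>2"
    by (simp add: power_mult_distrib power2_norm_eq_inner inner_vec_def[of A] sum_distrib_right)
  finally show ?thesis
    by (rule power2_le_imp_le) simp
qed

lemma norm_vector_matrix_le:
  fixes A :: "real^'m^'k"
  shows "norm (x v* A) \<le> norm x * norm A"
proof (cases "x v* A = 0")
  case False
  have "norm (x v* A) * norm (x v* A) = x \<bullet> (A *v (x v* A))"
    by (metis dot_lmul_matrix dot_square_norm power2_eq_square)
  also have "\<dots> \<le> norm x * (norm A * norm (x v* A))"
    by (meson Cauchy_Schwarz_ineq2 abs_le_D1 mult_left_mono norm_ge_zero norm_matrix_vector_le order_trans)
  finally show ?thesis using False by (simp add: mult.assoc[symmetric])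
qed simp

text \<open>\<open>smallest_eigenvalue\<close> is a \<open>Min\<close>, which is informative only
  for a finite set. One eigenvector per eigenvalue gives a pairwise orthogonal, hence independent,
  family, and such a family is finite.\<close>

lemma finite_eigenvalues_symmetric:
  fixes A :: "real^'m^'m"
  assumes "transpose A = A"
  shows "finite (eigenvalues A)"
proof -
  have sym: "(A *v u) \<bullet> v = u \<bullet> (A *v v)" for u v
    by (metis assms dot_lmul_matrix transpose_matrix_vector)
  obtain f where f: "\<And>l. l \<in> eigenvalues A \<Longrightarrow> f l \<noteq> 0 \<and> A *v f l = l *\<^sub>R f l"
    using bchoice[of "eigenvalues A" "\<lambda>l v. v \<noteq> 0 \<and> A *v v = l *\<^sub>R v"] unfolding eigenvalues_def by blast
  have orth: "f l \<bullet> f m = 0" if "l \<in> eigenvalues A" "m \<in> eigenvalues A" "l \<noteq> m" for l m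
    using sym[of "f l" "f m"] f[OF that(1)] f[OF that(2)] that(3) by auto
  have inj: "inj_on f (eigenvalues A)"
    using f orth by (metis inj_onI inner_eq_zero_iff)
  have "pairwise orthogonal (f ` eigenvalues A)"
    unfolding pairwise_def orthogonal_def using orth by auto
  moreover have "0 \<notin> f ` eigenvalues A" using f by auto
  ultimately have "independent (f ` eigenvalues A)" by (rule pairwise_orthogonal_independent)
  then have "finite (f ` eigenvalues A)" using independent_bound by auto
  then show ?thesis using inj finite_imageD by blast
qed

text \<open>The quadratic form attains its minimum \<open>m\<close> over the compact unit sphere. A
  minimiser is an eigenvector with eigenvalue \<open>m\<close>, so the smallest eigenvalue is at
  most \<open>m\<close>, and homogeneity carries the bound from the sphere to every
  \<open>w\<close>.\<close>

lemma quadratic_ge_smallest_eigenvalue: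
  fixes A :: "real^'m^'m"
  assumes symA: "transpose A = A"
  shows "smallest_eigenvalue A * (norm w)\<^sup>2 \<le> w \<bullet> (A *v w)"
proof -
  have sym: "(A *v u) \<bullet> v = u \<bullet> (A *v v)" for u v
    by (metis symA dot_lmul_matrix transpose_matrix_vector)
  define q where "q u = u \<bullet> (A *v u)" for u
  have "axis undefined 1 \<in> sphere (0::real^'m) 1" by (simp add: norm_axis_1)
  then have ne: "sphere (0::real^'m) 1 \<noteq> {}" by blast
  have "continuous_on (sphere 0 1) q"
    unfolding q_def by (intro continuous_on_inner continuous_on_id matrix_vector_mult_linear_continuous_on)
  then obtain v where v: "norm v = 1" and vmin: "\<And>u. norm u = 1 \<Longrightarrow> q v \<le> q u"
    using continuous_attains_inf[OF compact_sphere ne] by (metis mem_sphere_0)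
  define m where "m = q v"
  have ray: "m * (norm u)\<^sup>2 \<le> q u" for u
  proof (cases "u = 0")
    case False
    then have "m \<le> q (u /\<^sub>R norm u)" unfolding m_def by (intro vmin) simp
    also have "\<dots> = q u / (norm u)\<^sup>2"
      by (simp add: q_def matrix_vector_mult_scaleR divide_inverse power2_eq_square)
    finally show ?thesis using False by (simp add: field_simps)
  qed (simp add: q_def)
  text \<open>The first variation of the nonnegative form \<open>q u - m |u|\<^sup>2\<close> vanishes at its zero \<open>v\<close>.\<close>
  have "A *v v = m *\<^sub>R v"
  proof -
    define z where "z = A *v v - m *\<^sub>R v"
    have exp: "0 \<le> 2 * t * (z \<bullet> z) + t\<^sup>2 * (q z - m * (norm z)\<^sup>2)" for t
    proof -
      have "q (v + t *\<^sub>R z) = q v + 2 * t * (z \<bullet> (A *v v)) + t\<^sup>2 * q z"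
        using sym[of v z] unfolding q_def
        by (simp add: matrix_vector_right_distrib matrix_vector_mult_scaleR inner_add_left inner_add_right
            inner_commute[of "A *v v" z] power2_eq_square distrib_left mult.assoc)
      moreover have "(norm (v + t *\<^sub>R z))\<^sup>2 = 1 + 2 * t * (z \<bullet> v) + t\<^sup>2 * (norm z)\<^sup>2"
        using v unfolding power2_norm_eq_inner by (simp add: inner_add_left inner_add_right norm_eq_1
            inner_commute[of v z] power2_eq_square distrib_left mult.assoc)
      moreover have "z \<bullet> (A *v v) = z \<bullet> z + m * (z \<bullet> v)"
        using inner_add_right[of z z "m *\<^sub>R v"] by (simp add: z_def)
      ultimately show ?thesis using ray[of "v + t *\<^sub>R z"]
        by (simp add: m_def[symmetric] algebra_simps)
    qed
    \<comment> \<open>\<open>C\<close> is a positive bound on the quadratic coefficient. The choice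
      \<open>t = - (a / C)\<close> minimises the upper bound \<open>2 t a + t^2 C\<close>, with
      minimum \<open>- a^2 / C\<close>, so nonnegativity forces \<open>a = 0\<close>.\<close>
    define C where "C = \<bar>q z - m * (norm z)\<^sup>2\<bar> + 1"
    have C: "C > 0" "q z - m * (norm z)\<^sup>2 \<le> C" unfolding C_def by auto
    define a where "a = z \<bullet> z"
    have "0 \<le> 2 * (- (a / C)) * a + (a / C)\<^sup>2 * C"
      using exp[of "- (a / C)"] mult_left_mono[OF C(2), of "(a / C)\<^sup>2"] unfolding a_def[symmetric] by simp
    also have "\<dots> = - (a\<^sup>2 / C)" using C(1) by (simp add: power2_eq_square field_simps)
    finally have "a\<^sup>2 / C \<le> 0" by simp
    then have "a = 0" using C(1) by (simp add: divide_le_0_iff)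
    then show ?thesis unfolding a_def z_def by simp
  qed
  then have "m \<in> eigenvalues A" unfolding eigenvalues_def using v by (intro CollectI exI[of _ v]) auto
  then have "smallest_eigenvalue A \<le> m"
    unfolding smallest_eigenvalue_def using finite_eigenvalues_symmetric[OF symA] by simp
  then show ?thesis
    using ray[of w] mult_right_mono[of _ m "(norm w)\<^sup>2"] unfolding q_def by fastforce
qed

text \<open>The quadratic form of \<open>J ** transpose J\<close> at \<open>w\<close> is the squared
  norm of \<open>w v* J\<close>. This is the form in which (A5) is used.\<close>

lemma gram_lower_bound:
  fixes J :: "real^'m^'k"
  assumes "l \<le> smallest_eigenvalue (J ** transpose J)"
  shows "l * (norm w)\<^sup>2 \<le> (norm (w v* J))\<^sup>2"
proof -
  have "l * (norm w)\<^sup>2 \<le> w \<bullet> ((J ** transpose J) *v w)"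
    using quadratic_ge_smallest_eigenvalue[of "J ** transpose J" w] mult_right_mono[OF assms, of "(norm w)\<^sup>2"]
    by (force simp: matrix_transpose_mul)
  also have "\<dots> = (norm (w v* J))\<^sup>2"
    by (metis dot_lmul_matrix matrix_vector_mul_assoc power2_norm_eq_inner transpose_matrix_vector)
  finally show ?thesis .
qed

section \<open>Outputs as vectors, pullbacks and row projections\<close>

text \<open>An isometric reindexing: the rows of \<open>full_jacobian\<close> are indexed by pairs,
  so an output matrix must become a vector over pairs before it can multiply it.\<close>

definition flatten :: "real^'d^'n \<Rightarrow> real^('n \<times> 'd)" where
  "flatten W = (\<chi> p. W $ fst p $ snd p)"

text \<open>The adjoint of the derivative of \<open>Y\<close> at \<open>\<theta>\<close>. The exact
  gradient and the batch gradient are both images under this one linear map, which makes them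
  comparable.\<close>

definition pullback :: "(real^'s \<Rightarrow> real^'d^'n) \<Rightarrow> real^'s \<Rightarrow> real^'d^'n \<Rightarrow> real^'s" where
  "pullback Y \<theta> W = flatten W v* full_jacobian Y \<theta>"

lemma inner_flatten: "flatten W \<bullet> flatten Z = W \<bullet> Z"
  by (simp add: flatten_def inner_vec_def sum.cartesian_product case_prod_unfold flip: UNIV_Times_UNIV)

lemma norm_flatten: "norm (flatten W) = norm W"
  by (simp add: norm_eq_sqrt_inner inner_flatten)

lemma linear_flatten: "linear flatten"
  by (auto simp: linear_iff flatten_def vec_eq_iff)

lemma linear_pullback: "linear (pullback Y \<theta>)"
  unfolding pullback_def
  by (rule linearI) (simp_all add: linear_add[OF linear_flatten] linear_scale[OF linear_flatten]
      vector_matrix_left_distrib scaleR_vector_matrix_assoc)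

definition row_proj :: "'n set \<Rightarrow> real^'d^'n \<Rightarrow> real^'d^'n" where
  "row_proj S W = (\<chi> n. if n \<in> S then W $ n else 0)"

lemma norm_row_proj: "(norm (row_proj S W))\<^sup>2 = (\<Sum>n\<in>UNIV. of_bool (n \<in> S) * (norm (W $ n))\<^sup>2)"
  unfolding power2_norm_eq_inner inner_vec_def[of "row_proj S W"]
  by (intro sum.cong) (auto simp: row_proj_def)

lemma norm_sq_rows: "(norm (W::'a::real_inner^'n))\<^sup>2 = (\<Sum>n\<in>UNIV. (norm (W $ n))\<^sup>2)"
  unfolding power2_norm_eq_inner inner_vec_def[of W] ..

text \<open>Together with \<open>norm_row_proj\<close> this isolates the dependence on the random
  set \<open>S\<close> in the indicators; the coefficients do not involve \<open>S\<close>.\<close>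

lemma row_proj_eq_sum: "row_proj S W = (\<Sum>n\<in>UNIV. of_bool (n \<in> S) *\<^sub>R row_proj {n} W)"
proof (subst vec_eq_iff, rule allI)
  fix i
  have "(\<Sum>n\<in>UNIV. of_bool (n \<in> S) *\<^sub>R row_proj {n} W) $ i =
      (\<Sum>n\<in>UNIV. if n = i then of_bool (n \<in> S) *\<^sub>R W $ i else 0)"
    unfolding sum_component by (intro sum.cong) (auto simp: row_proj_def)
  then show "row_proj S W $ i = (\<Sum>n\<in>UNIV. of_bool (n \<in> S) *\<^sub>R row_proj {n} W) $ i"
    by (simp add: row_proj_def)
qed

lemma row_proj_UNIV: "row_proj UNIV W = W"
  by (simp add: row_proj_def vec_eq_iff)

text \<open>Zeroing the unsampled rows before the full pullback drops exactly their Jacobian blocks.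
  Bounds on \<open>full_jacobian\<close> thus apply to every batch.\<close>

lemma batch_gradient_eq_pullback:
  "batch_gradient Y G S Z \<theta> = pullback Y \<theta> (row_proj S (G Z (Y \<theta>)))"
proof (subst vec_eq_iff, rule allI)
  fix j
  let ?W = "G Z (Y \<theta>)"
  have "pullback Y \<theta> (row_proj S ?W) $ j
      = (\<Sum>p\<in>UNIV. full_jacobian Y \<theta> $ p $ j * row_proj S ?W $ fst p $ snd p)"
    by (simp add: pullback_def flatten_def vector_matrix_mult_def mult.commute)
  also have "\<dots> = (\<Sum>n\<in>UNIV. \<Sum>c\<in>UNIV. row_jacobian Y n \<theta> $ c $ j * row_proj S ?W $ n $ c)"
    by (simp add: full_jacobian_def sum.cartesian_product case_prod_unfold flip: UNIV_Times_UNIV)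
  also have "\<dots> = (\<Sum>n\<in>UNIV. if n \<in> S then (\<Sum>c\<in>UNIV. row_jacobian Y n \<theta> $ c $ j * ?W $ n $ c) else 0)"
    by (intro sum.cong) (auto simp: row_proj_def)
  also have "\<dots> = (\<Sum>n\<in>S. (\<Sum>c\<in>UNIV. row_jacobian Y n \<theta> $ c $ j * ?W $ n $ c))"
    by (simp add: sum.If_cases)
  finally show "batch_gradient Y G S Z \<theta> $ j = pullback Y \<theta> (row_proj S ?W) $ j"
    by (simp add: batch_gradient_def vector_matrix_mult_def mult.commute)
qed

lemma norm_pullback_le: "norm (pullback Y \<theta> W) \<le> norm (full_jacobian Y \<theta>) * norm W"
  unfolding pullback_def using norm_vector_matrix_le[of "flatten W" "full_jacobian Y \<theta>"]
  by (simp add: norm_flatten mult.commute)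

lemma pullback_lower_bound:
  assumes "l \<le> smallest_eigenvalue (full_jacobian Y \<theta> ** transpose (full_jacobian Y \<theta>))"
  shows "l * (norm W)\<^sup>2 \<le> (norm (pullback Y \<theta> W))\<^sup>2"
  using gram_lower_bound[OF assms, of "flatten W"] by (simp add: pullback_def norm_flatten)

section \<open>First and second derivatives of the output map\<close>

lemma has_derivative_flatten_jacobian:
  assumes "C2 (Y :: real^'s \<Rightarrow> real^'d^'n)"
  shows "((\<lambda>\<phi>. flatten (Y \<phi>)) has_derivative (*v) (full_jacobian Y \<theta>)) (at \<theta>)"
proof -
  obtain Y' where Y': "\<And>x. (Y has_derivative blinfun_apply (Y' x)) (at x)"
    using assms unfolding C2_def by auto
  have row: "((\<lambda>\<phi>. Y \<phi> $ n) has_derivative (*v) (row_jacobian Y n \<theta>)) (at \<theta>)" for n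
  proof -
    have "(\<lambda>\<phi>. Y \<phi> $ n) differentiable (at \<theta>)"
      using bounded_linear.has_derivative[OF bounded_linear_vec_nth Y'] differentiableI by blast
    then show ?thesis unfolding row_jacobian_def jacobian_works by (simp add: eta_contract_eq)
  qed
  show ?thesis
  proof (subst has_derivative_componentwise_within, intro ballI)
    fix i :: "real^('n \<times> 'd)" assume "i \<in> Basis"
    then obtain p where i: "i = axis p 1" by (auto simp: Basis_vec_def)
    have "((\<lambda>\<phi>. Y \<phi> $ fst p $ snd p) has_derivative (\<lambda>h. (row_jacobian Y (fst p) \<theta> *v h) $ snd p)) (at \<theta>)"
      by (rule bounded_linear.has_derivative[OF bounded_linear_vec_nth row])
    then show "((\<lambda>x. flatten (Y x) \<bullet> i) has_derivative (\<lambda>x. (full_jacobian Y \<theta> *v x) \<bullet> i)) (at \<theta>)"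
      by (simp add: i inner_axis flatten_def full_jacobian_def matrix_vector_mult_def)
  qed
qed

lemma norm_second_deriv_apply:
  fixes T :: "real^'s^'s^'d^'n"
  shows "norm (\<chi> p::'n \<times> 'd. T $ fst p $ snd p *v v) \<le> norm T * norm v"
proof (rule power2_le_imp_le)
  have "(norm (\<chi> p::'n \<times> 'd. T $ fst p $ snd p *v v))\<^sup>2
      = (\<Sum>p\<in>UNIV. (norm (T $ fst p $ snd p *v v))\<^sup>2)"
    by (subst norm_sq_rows) simp
  also have "\<dots> \<le> (\<Sum>p\<in>(UNIV::('n\<times>'d) set). (norm (T $ fst p $ snd p) * norm v)\<^sup>2)"
    by (intro sum_mono power_mono norm_matrix_vector_le norm_ge_zero)
  also have "\<dots> = (\<Sum>n\<in>UNIV. \<Sum>c\<in>UNIV. (norm (T $ n $ c))\<^sup>2 * (norm v)\<^sup>2)"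
    by (simp add: sum.cartesian_product case_prod_unfold power_mult_distrib flip: UNIV_Times_UNIV)
  also have "\<dots> = (norm T * norm v)\<^sup>2"
    by (simp add: norm_sq_rows[of T] norm_sq_rows[of "T $ _"] power_mult_distrib sum_distrib_right)
  finally show "(norm (\<chi> p::'n \<times> 'd. T $ fst p $ snd p *v v))\<^sup>2 \<le> (norm T * norm v)\<^sup>2" .
qed simp

text \<open>Each Jacobian entry is a bounded linear functional of the derivative of
  \<open>Y\<close>: evaluation at a basis vector followed by a coordinate. Differentiability of that
  derivative therefore passes to the entries, and from them to the rows.\<close>

lemma has_derivative_full_jacobian:
  assumes "C2 (Y :: real^'s \<Rightarrow> real^'d^'n)"
  shows "(full_jacobian Y has_derivative (\<lambda>v. \<chi> p. second_deriv Y \<theta> $ fst p $ snd p *v v)) (at \<theta>)"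
proof -
  obtain Y' Y'' where Y': "\<And>x. (Y has_derivative blinfun_apply (Y' x)) (at x)"
    and Y'': "\<And>x. (Y' has_derivative blinfun_apply (Y'' x)) (at x)"
    using assms unfolding C2_def C1_def by auto
  have fr: "frechet_derivative (\<lambda>\<phi>. Y \<phi> $ n) (at \<phi>) = (\<lambda>h. blinfun_apply (Y' \<phi>) h $ n)" for n \<phi>
    by (rule frechet_derivative_at[OF bounded_linear.has_derivative[OF bounded_linear_vec_nth Y'], symmetric])
  have entry: "row_jacobian Y n \<phi> $ c $ j = blinfun_apply (Y' \<phi>) (axis j 1) $ n $ c" for n \<phi> c j
    by (simp add: row_jacobian_def jacobian_def fr matrix_def)
  have dentry: "(\<lambda>\<phi>. row_jacobian Y n \<phi> $ c $ j) differentiable (at \<theta>)" for n c j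
  proof -
    have "bounded_linear (\<lambda>A. blinfun_apply A (axis j 1) $ n $ c)"
      by (intro bounded_linear_vec_nth[THEN bounded_linear_compose] blinfun.bounded_linear_left)
    from bounded_linear.has_derivative[OF this Y''[of \<theta>]]
    show ?thesis unfolding entry differentiable_def by blast
  qed
  have dr: "((\<lambda>\<phi>. row_jacobian Y n \<phi> $ c) has_derivative (*v) (second_deriv Y \<theta> $ n $ c)) (at \<theta>)" for n c
  proof -
    have "(\<lambda>\<phi>. row_jacobian Y n \<phi> $ c) differentiable (at \<theta>)"
    proof (subst differentiable_componentwise_within, intro ballI)
      fix i :: "real^'s" assume "i \<in> Basis"
      then obtain j where "i = axis j 1" by (auto simp: Basis_vec_def)
      then show "(\<lambda>x. row_jacobian Y n x $ c \<bullet> i) differentiable (at \<theta>)"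
        using dentry by (simp add: inner_axis)
    qed
    then show ?thesis unfolding jacobian_works by (simp add: second_deriv_def)
  qed
  show ?thesis
  proof (subst has_derivative_componentwise_within, intro ballI)
    fix i :: "real^'s^('n \<times> 'd)" assume "i \<in> Basis"
    then obtain p u where i: "i = axis p u" by (auto simp: Basis_vec_def)
    have "((\<lambda>\<phi>. row_jacobian Y (fst p) \<phi> $ snd p \<bullet> u) has_derivative
        (\<lambda>h. (second_deriv Y \<theta> $ fst p $ snd p *v h) \<bullet> u)) (at \<theta>)"
      by (rule bounded_linear.has_derivative[OF bounded_linear_inner_left dr])
    then show "((\<lambda>x. full_jacobian Y x \<bullet> i) has_derivative
        (\<lambda>v. (\<chi> p. second_deriv Y \<theta> $ fst p $ snd p *v v) \<bullet> i)) (at \<theta>)"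
      by (simp add: i inner_axis full_jacobian_def)
  qed
qed

lemma lipschitz_full_jacobian:
  assumes "C2 (Y :: real^'s \<Rightarrow> real^'d^'n)" "convex \<Omega>"
    and "\<And>\<phi>. \<phi> \<in> \<Omega> \<Longrightarrow> norm (second_deriv Y \<phi>) \<le> K"
    and "x \<in> \<Omega>" "y \<in> \<Omega>"
  shows "norm (full_jacobian Y x - full_jacobian Y y) \<le> K * norm (x - y)"
proof (rule differentiable_bound[OF assms(2) _ _ assms(4,5)])
  fix \<phi> assume "\<phi> \<in> \<Omega>"
  show "(full_jacobian Y has_derivative (\<lambda>v. \<chi> p. second_deriv Y \<phi> $ fst p $ snd p *v v)) (at \<phi> within \<Omega>)"
    by (rule has_derivative_at_withinI[OF has_derivative_full_jacobian[OF assms(1)]])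
  show "onorm (\<lambda>v. \<chi> p. second_deriv Y \<phi> $ fst p $ snd p *v v) \<le> K"
    by (rule onorm_le)
      (rule order_trans[OF norm_second_deriv_apply mult_right_mono[OF assms(3)[OF \<open>\<phi> \<in> \<Omega>\<close>] norm_ge_zero]])
qed

lemma lipschitz_of_jacobian_bound:
  assumes "C2 (Y :: real^'s \<Rightarrow> real^'d^'n)" "convex \<Omega>"
    and "\<And>\<phi>. \<phi> \<in> \<Omega> \<Longrightarrow> norm (full_jacobian Y \<phi>) \<le> K"
    and "x \<in> \<Omega>" "y \<in> \<Omega>"
  shows "norm (Y x - Y y) \<le> K * norm (x - y)"
proof -
  have "norm (flatten (Y x) - flatten (Y y)) \<le> K * norm (x - y)"
  proof (rule differentiable_bound[OF assms(2) _ _ assms(4,5)])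
    fix \<phi> assume "\<phi> \<in> \<Omega>"
    show "((\<lambda>\<phi>. flatten (Y \<phi>)) has_derivative (*v) (full_jacobian Y \<phi>)) (at \<phi> within \<Omega>)"
      by (rule has_derivative_at_withinI[OF has_derivative_flatten_jacobian[OF assms(1)]])
    show "onorm ((*v) (full_jacobian Y \<phi>)) \<le> K"
      by (rule onorm_le)
        (rule order_trans[OF norm_matrix_vector_le mult_right_mono[OF assms(3)[OF \<open>\<phi> \<in> \<Omega>\<close>] norm_ge_zero]])
  qed
  then show ?thesis by (simp add: norm_flatten flip: linear_diff[OF linear_flatten])
qed

section \<open>Gradients, the descent inequality and convexity\<close>

text \<open>\<open>grad\<close> is a definite description, so existence and uniqueness both have to
  be shown. The Riesz vector is the adjoint of the derivative applied to 1.\<close>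

lemma GDERIV_grad:
  fixes F :: "'a::euclidean_space \<Rightarrow> real"
  assumes "C1 F"
  shows "GDERIV F x :> grad F x"
proof -
  obtain f' where f: "(F has_derivative blinfun_apply f') (at x)"
    using assms unfolding C1_def by blast
  define g where "g = adjoint (blinfun_apply f') 1"
  have "blinfun_apply f' h = h \<bullet> g" for h
    using adjoint_works[OF bounded_linear.linear[OF blinfun.bounded_linear_right], of h f' 1]
    by (simp add: g_def)
  then have g: "GDERIV F x :> g" using f unfolding gderiv_def by (metis (no_types, lifting) ext)
  have "g' = g" if "GDERIV F x :> g'" for g'
  proof -
    have "(\<lambda>h. h \<bullet> g') = (\<lambda>h. h \<bullet> g)"
      using has_derivative_unique that g unfolding gderiv_def by blast
    then show ?thesis by (metis vector_eq_ldot)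
  qed
  with g show ?thesis unfolding grad_def by (metis theI)
qed

lemma GDERIV_comp_pullback:
  fixes Y :: "real^'s \<Rightarrow> real^'d^'n"
  assumes "C2 Y" "C1 F"
  shows "GDERIV (\<lambda>\<phi>. F (Y \<phi>)) \<theta> :> pullback Y \<theta> (grad F (Y \<theta>))"
proof -
  obtain Y' where Y': "(Y has_derivative blinfun_apply Y') (at \<theta>)"
    using assms unfolding C2_def by blast
  have "((\<lambda>\<phi>. flatten (Y \<phi>)) has_derivative (\<lambda>h. flatten (blinfun_apply Y' h))) (at \<theta>)"
    by (rule bounded_linear.has_derivative[OF _ Y']) (simp add: linear_flatten linear_linear)
  then have eq: "flatten (blinfun_apply Y' h) = full_jacobian Y \<theta> *v h" for h
    using has_derivative_unique has_derivative_flatten_jacobian[OF assms(1)] by metis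
  have "blinfun_apply Y' h \<bullet> grad F (Y \<theta>) = h \<bullet> pullback Y \<theta> (grad F (Y \<theta>))" for h
    by (metis eq inner_flatten dot_lmul_matrix inner_commute pullback_def)
  moreover have "((\<lambda>\<phi>. F (Y \<phi>)) has_derivative (\<lambda>h. blinfun_apply Y' h \<bullet> grad F (Y \<theta>))) (at \<theta>)"
    using has_derivative_compose[OF Y' GDERIV_grad[OF assms(2), unfolded gderiv_def]] .
  ultimately show ?thesis unfolding gderiv_def by simp
qed

lemma has_derivative_affine_line: "((\<lambda>t. x + t *\<^sub>R d) has_derivative (\<lambda>s. s *\<^sub>R d)) F"
  using has_derivative_add[OF has_derivative_const
      bounded_linear.has_derivative[OF bounded_linear_scaleR_left has_derivative_ident]] by simp

lemma DERIV_along_line: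
  assumes "GDERIV f (x + t *\<^sub>R d) :> g"
  shows "((\<lambda>t. f (x + t *\<^sub>R d)) has_real_derivative g \<bullet> d) (at t)"
proof -
  have "((\<lambda>t. f (x + t *\<^sub>R d)) has_derivative (\<lambda>s. (s *\<^sub>R d) \<bullet> g)) (at t)"
    using has_derivative_compose[where f = "\<lambda>t. x + t *\<^sub>R d" and g = f,
        OF has_derivative_affine_line assms[unfolded gderiv_def]] .
  moreover have "(\<lambda>s. (s *\<^sub>R d) \<bullet> g) = (*) (g \<bullet> d)"
    by (simp add: fun_eq_iff inner_commute mult.commute)
  ultimately show ?thesis unfolding has_field_derivative_def by simp
qed

lemma descent_inequality:
  fixes f :: "'a::real_inner \<Rightarrow> real"
  assumes "convex S" "x \<in> S" "y \<in> S"
    and grad: "\<And>z. z \<in> S \<Longrightarrow> GDERIV f z :> g z"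
    and lip: "\<And>z. z \<in> S \<Longrightarrow> norm (g z - g x) \<le> K * norm (z - x)"
  shows "f y \<le> f x + g x \<bullet> (y - x) + K / 2 * (norm (y - x))\<^sup>2"
proof -
  define d where "d = y - x"
  \<comment> \<open>\<open>h\<close> is \<open>f\<close> on the segment minus the linear and
    quadratic terms of the claimed bound. The Lipschitz estimate makes its derivative nonpositive,
    and \<open>h 1 \<le> h 0\<close> is the claim.\<close>
  define h where "h t = f (x + t *\<^sub>R d) - t * (g x \<bullet> d) - K / 2 * t\<^sup>2 * (norm d)\<^sup>2" for t
  have inS: "x + t *\<^sub>R d \<in> S" if "0 \<le> t" "t \<le> 1" for t
    using convexD_alt[OF assms(1,2,3), of t] that by (simp add: d_def algebra_simps)
  have "h 1 \<le> h 0"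
  proof (rule DERIV_nonpos_imp_nonincreasing[of 0 1 h])
    fix t :: real assume t: "0 \<le> t" "t \<le> 1"
    have *: "((\<lambda>t. f (x + t *\<^sub>R d)) has_real_derivative g (x + t *\<^sub>R d) \<bullet> d) (at t)"
      by (rule DERIV_along_line[OF grad[OF inS[OF t]]])
    have D: "(h has_real_derivative g (x + t *\<^sub>R d) \<bullet> d - g x \<bullet> d - K * t * (norm d)\<^sup>2) (at t)"
      unfolding h_def by (rule derivative_eq_intros * refl | simp)+
    have "(g (x + t *\<^sub>R d) - g x) \<bullet> d \<le> norm (g (x + t *\<^sub>R d) - g x) * norm d"
      by (rule norm_cauchy_schwarz)
    also have "\<dots> \<le> K * (t * norm d) * norm d"
      using lip[OF inS[OF t]] t by (intro mult_right_mono) auto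
    finally have "g (x + t *\<^sub>R d) \<bullet> d - g x \<bullet> d - K * t * (norm d)\<^sup>2 \<le> 0"
      by (simp add: inner_diff_left power2_eq_square)
    with D show "\<exists>y. (h has_real_derivative y) (at t) \<and> y \<le> 0" by blast
  qed simp
  then show ?thesis by (simp add: h_def d_def)
qed

text \<open>Convexity bounds each difference quotient towards \<open>y\<close> by
  \<open>f y - f x\<close>. The limit as \<open>t\<close> decreases to 0 gives the supporting-line
  inequality, and Cauchy-Schwarz the rest.\<close>

lemma convex_gradient_bound:
  fixes f :: "'a::real_inner \<Rightarrow> real"
  assumes "convex_on S f" "x \<in> S" "y \<in> S" and grad: "GDERIV f x :> g"
  shows "f x - f y \<le> norm g * norm (x - y)"
proof -
  define d where "d = y - x"
  have "((\<lambda>t. f (x + t *\<^sub>R d)) has_real_derivative g \<bullet> d) (at 0)"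
    by (rule DERIV_along_line) (simp add: grad)
  then have lim: "((\<lambda>t. (f (x + t *\<^sub>R d) - f x) / t) \<longlongrightarrow> g \<bullet> d) (at_right 0)"
    unfolding has_field_derivative_iff by (simp add: filterlim_at_split)
  have "g \<bullet> d \<le> f y - f x"
  proof (rule tendsto_upperbound[OF lim])
    have "(f (x + t *\<^sub>R d) - f x) / t \<le> f y - f x" if "t > 0" "t < 1" for t
    proof -
      have "f (x + t *\<^sub>R d) \<le> (1 - t) * f x + t * f y"
        using convex_onD[OF assms(1), of t x y] assms(2,3) that by (simp add: d_def algebra_simps)
      then show ?thesis using that by (simp add: field_simps)
    qed
    then show "\<forall>\<^sub>F t in at_right 0. (f (x + t *\<^sub>R d) - f x) / t \<le> f y - f x"
      by (intro eventually_at_rightI[of 0 1]) auto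
  qed simp
  moreover have "- (g \<bullet> d) \<le> norm g * norm d"
    using norm_cauchy_schwarz[of "- g" d] by simp
  ultimately show ?thesis by (simp add: d_def norm_minus_commute)
qed

section \<open>Scalar recursions and the constants\<close>

text \<open>For \<open>x = p * W n\<close> the next value is at most \<open>x - x^2\<close>. This
  increases in \<open>x\<close> up to 1/2, so \<open>x\<close> may be replaced there by
  \<open>1/n\<close>, and \<open>1/n - 1/n^2 \<le> 1/(n+1)\<close>.\<close>

lemma inverse_rate_of_quadratic_decrease:
  fixes W :: "nat \<Rightarrow> real"
  assumes "p > 0" and step: "\<And>k. W (Suc k) \<le> W k - p * (W k)\<^sup>2" and "k \<ge> 1"
  shows "W k \<le> 1 / (p * real k)"
  using \<open>k \<ge> 1\<close>
proof (induction k rule: dec_induct)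
  case base
  have "0 \<le> (1 / 2 - p * W 0)\<^sup>2 + 3 / 4" by (simp add: add_nonneg_nonneg)
  then have "p * (W 0 - p * (W 0)\<^sup>2) \<le> 1" by (simp add: power2_eq_square algebra_simps)
  then have "W 0 - p * (W 0)\<^sup>2 \<le> 1 / p" using \<open>p > 0\<close> by (simp add: field_simps)
  then show ?case using step[of 0] by simp
next
  case (step n)
  define x where "x = p * W n"
  have n: "real n \<ge> 1" using step.hyps by simp
  have x: "x \<le> 1 / real n" using step.IH \<open>p > 0\<close> n by (simp add: x_def field_simps)
  have "x - x\<^sup>2 \<le> 1 / (real n + 1)"
  \<comment> \<open>At \<open>n = 1\<close> the induction bound 1 lies beyond 1/2, where
    \<open>x - x^2\<close> stops increasing; a global bound serves instead.\<close>
  proof (cases "n = 1")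
    case True
    have "0 \<le> (1 / 2 - x)\<^sup>2 + 1/4" by (simp add: add_nonneg_nonneg)
    then have "x - x\<^sup>2 \<le> 1 / 2" by (simp add: power2_eq_square algebra_simps)
    then show ?thesis using True by simp
  next
    case False
    then have n2: "real n \<ge> 2" using step.hyps by linarith
    define y where "y = 1 / real n"
    have y: "0 < y" "y \<le> 1 / 2" "y * real n = 1" using n2 by (auto simp: y_def field_simps)
    have "0 \<le> (y - x) * (1 - (x + y))" using x[folded y_def] y(2) by (intro mult_nonneg_nonneg) auto
    then have "x - x\<^sup>2 \<le> y - y\<^sup>2" by (simp add: power2_eq_square algebra_simps)
    also have "y - y\<^sup>2 \<le> 1 / (real n + 1)"
    proof -
      have "(y - y\<^sup>2) * (real n + 1) = y * real n + y - (y * real n) * y - y\<^sup>2"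
        by (simp add: power2_eq_square algebra_simps)
      also have "\<dots> \<le> 1" using y(3) by simp
      finally show ?thesis using n by (simp add: field_simps)
    qed
    finally show ?thesis .
  qed
  moreover have "p * W (Suc n) \<le> x - x\<^sup>2"
    using mult_left_mono[OF assms(2)[of n], of p] \<open>p > 0\<close>
    by (simp add: x_def power2_eq_square algebra_simps)
  ultimately have "p * W (Suc n) \<le> 1 / (real n + 1)" by linarith
  then show ?case using \<open>p > 0\<close> n by (simp add: pos_le_divide_eq mult_ac add_ac)
qed

text \<open>\<open>\<kappa>\<close> weighs the cache error in the Lyapunov function.\<close>

lemma lyapunov_weight_exists:
  fixes \<beta> \<mu> \<nu> \<eta> B1 B3 c2 c4 c5 l :: real
  assumes \<beta>: "0 < \<beta>" "\<beta> < 1" and \<mu>: "\<mu> = sqrt (1 - \<beta>)"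
    and pos: "B1 > 0" "B3 > 0" "c2 > 0" "c4 > 0" "\<eta> > 0" "l \<le> B1\<^sup>2"
    and \<nu>: "\<nu> = \<mu> / (1 - c4 * \<eta>)"
    and c5: "c5 = 4 * c2 + \<beta> / 2 * B1^4 + 2 * \<beta> * B1^4 * B3\<^sup>2 / (\<mu> * (1 - \<mu>) * (1 - \<nu>))"
    and \<eta>1: "c4 * \<eta> < \<beta> / 2"
    and \<eta>2: "\<eta> < sqrt (2 * \<mu> * (1 - \<mu>)) * \<beta> / (8 * B1\<^sup>2 * B3 * (2 - \<beta>))"
    and \<eta>3: "\<eta> * c5 < \<beta> * l"
  shows "\<exists>\<kappa>>0. \<exists>c>0. \<exists>c'>0.
    c \<le> \<beta> * l * \<eta> - \<beta> / 2 * \<eta>\<^sup>2 * B1^4 - 2 * c2 * \<eta>\<^sup>2 * \<beta> - 2 * \<kappa> * \<beta> * B1^4 * \<eta>\<^sup>2 / (1 - \<mu>) \<and>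
    c' \<le> \<kappa> * (1 - \<mu>) - \<beta> / 2 * B3\<^sup>2 - 2 * c2 * \<eta>\<^sup>2 * \<beta> * B3\<^sup>2 - 2 * \<kappa> * \<beta> * B1^4 * \<eta>\<^sup>2 * B3\<^sup>2 / (1 - \<mu>)"
proof -
  have \<mu>2: "\<mu>\<^sup>2 = 1 - \<beta>" using \<beta> \<mu> by simp
  have \<mu>0: "0 < \<mu>" "\<mu> < 1" using \<beta> \<mu> by auto
  have fac: "\<beta> = (1 - \<mu>) * (1 + \<mu>)" using \<mu>2 by (simp add: power2_eq_square algebra_simps)
  also have "\<dots> \<le> (1 - \<mu>) * 2" using \<mu>0 by (intro mult_left_mono) auto
  finally have half: "\<beta> / 2 \<le> 1 - \<mu>" by simp
  have d0: "0 < 1 - c4 * \<eta>" "1 - c4 * \<eta> < 1" using \<eta>1 \<beta> pos by auto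
  \<comment> \<open>Expanding the square with \<open>\<mu>^2 = 1 - \<beta>\<close> gives
    \<open>\<mu> \<le> 1 - \<beta>/2\<close>. The condition on \<open>c4 * \<eta>\<close> then puts
    \<open>\<mu>\<close> below \<open>1 - c4 * \<eta>\<close>, so \<open>\<nu> < 1\<close> and the
    last denominator in \<open>c5\<close> is positive.\<close>
  have "0 \<le> (1 - \<mu>)\<^sup>2" by simp
  then have "\<mu> \<le> 1 - \<beta> / 2" using \<mu>2 by (simp add: power2_diff)
  then have "\<mu> < 1 - c4 * \<eta>" using \<eta>1 by simp
  then have \<nu>1: "\<nu> < 1" using d0 by (simp add: \<nu>)
  have \<nu>\<mu>: "\<mu> \<le> \<nu>" using d0 \<mu>0 pos by (simp add: \<nu> field_simps)
  \<comment> \<open>\<open>q\<close> is the last term of \<open>c5\<close> with \<open>\<nu>\<close>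
    replaced by \<open>\<mu>\<close>. As \<open>\<mu> \<le> \<nu> < 1\<close> it is no larger, and
    it has the shape of the drift cost of \<open>\<kappa>\<close>.\<close>
  define q where "q = 2 * \<beta> * B1^4 * B3\<^sup>2 / (\<mu> * (1 - \<mu>)\<^sup>2)"
  have "2 * \<beta> * B1^4 * B3\<^sup>2 / (\<mu> * (1 - \<mu>) * (1 - \<mu>)) \<le> 2 * \<beta> * B1^4 * B3\<^sup>2 / (\<mu> * (1 - \<mu>) * (1 - \<nu>))"
    using \<mu>0 \<nu>1 \<nu>\<mu> \<beta> by (intro divide_left_mono mult_left_mono mult_pos_pos mult_nonneg_nonneg) auto
  then have c5q: "4 * c2 + \<beta> / 2 * B1^4 + q \<le> c5" by (simp add: c5 q_def power2_eq_square mult.assoc)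
  have q0: "q \<ge> 0" using \<beta> \<mu>0 by (simp add: q_def)
  text \<open>By AM-GM, \<open>4 c\<^sub>2 \<eta>\<^sup>2\<close> is bounded through the two first terms of \<open>c\<^sub>5\<close>.\<close>
  have D: "4 * c2 * \<eta>\<^sup>2 \<le> 1 / 2"
  proof -
    define x y where "x = 4 * c2 * \<eta>" and "y = \<beta> / 2 * B1^4 * \<eta>"
    have "x + y \<le> \<eta> * c5"
      using mult_left_mono[of "4 * c2 + \<beta> / 2 * B1^4" c5 \<eta>] c5q q0 pos unfolding x_def y_def
      by (simp add: algebra_simps)
    also have "\<dots> \<le> \<beta> * B1\<^sup>2" using \<eta>3 mult_left_mono[OF pos(6), of \<beta>] \<beta> by linarith
    finally have xy: "x + y \<le> \<beta> * B1\<^sup>2" .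
    have xy0: "0 \<le> x" "0 \<le> y" unfolding x_def y_def using pos \<beta> by auto
    have "0 \<le> (x - y)\<^sup>2" by simp
    then have "4 * (x * y) \<le> (x + y)\<^sup>2" by (simp add: power2_eq_square algebra_simps)
    also have "\<dots> \<le> (\<beta> * B1\<^sup>2)\<^sup>2" using xy xy0 by (intro power_mono) auto
    finally have "(\<beta> * B1^4) * (8 * c2 * \<eta>\<^sup>2) \<le> (\<beta> * B1^4) * \<beta>"
      unfolding x_def y_def by (simp add: power_mult_distrib power2_eq_square algebra_simps eval_nat_numeral)
    then have "8 * c2 * \<eta>\<^sup>2 \<le> \<beta>"
      using pos \<beta> by (subst (asm) mult_le_cancel_left_pos) auto
    then show ?thesis using \<beta> by linarith
  qed
  \<comment> \<open>\<open>D\<close> is chosen so that half of \<open>\<kappa> * (1 - \<mu>)\<close>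
    equals the two subtracted terms in the bound for \<open>c'\<close> that do not contain
    \<open>\<kappa>\<close>. The drift term takes at most another eighth, which leaves the factor
    3/8 in \<open>c'\<close>.\<close>
  define D where "D = 1 + 4 * c2 * \<eta>\<^sup>2"
  define \<kappa> where "\<kappa> = \<beta> * B3\<^sup>2 * D / (1 - \<mu>)"
  have D1: "1 \<le> D" "D \<le> 3 / 2" using D pos by (auto simp: D_def)
  have \<kappa>0: "\<kappa> > 0" unfolding \<kappa>_def using \<beta> pos D1 \<mu>0 by simp
  define c where "c = \<beta> * l * \<eta> - \<eta>\<^sup>2 * c5"
  define c' where "c' = 3 / 8 * \<kappa> * (1 - \<mu>)"
  have "c = \<eta> * (\<beta> * l - \<eta> * c5)" by (simp add: c_def power2_eq_square algebra_simps)
  then have c0: "c > 0" using \<eta>3 pos by simp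
  have c'0: "c' > 0" unfolding c'_def using \<kappa>0 \<mu>0 by simp
  have A: "c \<le> \<beta> * l * \<eta> - \<beta> / 2 * \<eta>\<^sup>2 * B1^4 - 2 * c2 * \<eta>\<^sup>2 * \<beta> - 2 * \<kappa> * \<beta> * B1^4 * \<eta>\<^sup>2 / (1 - \<mu>)"
  proof -
    \<comment> \<open>With \<open>\<beta> = (1 - \<mu>) * (1 + \<mu>)\<close> this gives
      \<open>\<beta> * \<mu> \<le> 1/2\<close>, and \<open>D \<le> 3/2\<close> then yields
      \<open>\<beta> * D \<le> 1 / \<mu>\<close>, which is what lets \<open>q\<close> cover the
      drift cost.\<close>
    have "\<mu> * (1 - \<mu>) \<le> 1 / 4"
      using zero_le_power2[of "\<mu> - 1/2"] by (simp add: power2_eq_square algebra_simps)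
    then have "\<mu> * (1 - \<mu>) * (1 + \<mu>) \<le> 1 / 4 * 2" using \<mu>0 by (intro mult_mono) auto
    then have bm: "\<beta> * \<mu> \<le> 1 / 2" unfolding fac by (simp add: mult_ac)
    have "\<beta> * \<mu> * D \<le> 1 / 2 * (3 / 2)" using bm D1 \<mu>0 by (intro mult_mono) auto
    then have "\<beta> * D \<le> 1 / \<mu>" using \<mu>0 by (simp add: field_simps)
    then have "2 * \<beta> * B1^4 * B3\<^sup>2 / (1 - \<mu>)\<^sup>2 * (\<beta> * D) \<le> 2 * \<beta> * B1^4 * B3\<^sup>2 / (1 - \<mu>)\<^sup>2 * (1 / \<mu>)"
      using \<beta> by (intro mult_left_mono) auto
    moreover have "2 * \<kappa> * \<beta> * B1^4 / (1 - \<mu>) = 2 * \<beta> * B1^4 * B3\<^sup>2 / (1 - \<mu>)\<^sup>2 * (\<beta> * D)"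
      by (simp add: \<kappa>_def power2_eq_square)
    ultimately have kq: "2 * \<kappa> * \<beta> * B1^4 / (1 - \<mu>) \<le> q" by (simp add: q_def mult_ac)
    have "2 * c2 * \<beta> \<le> 4 * c2" using \<beta> pos by simp
    then have "\<beta> / 2 * B1^4 + 2 * c2 * \<beta> + 2 * \<kappa> * \<beta> * B1^4 / (1 - \<mu>) \<le> c5" using kq c5q by linarith
    from mult_left_mono[OF this, of "\<eta>\<^sup>2"] show ?thesis
      by (simp add: c_def algebra_simps)
  qed
  have B: "c' \<le> \<kappa> * (1 - \<mu>) - \<beta> / 2 * B3\<^sup>2 - 2 * c2 * \<eta>\<^sup>2 * \<beta> * B3\<^sup>2
      - 2 * \<kappa> * \<beta> * B1^4 * \<eta>\<^sup>2 * B3\<^sup>2 / (1 - \<mu>)"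
  proof -
    have den: "8 * B1\<^sup>2 * B3 * (2 - \<beta>) > 0" using pos \<beta> by simp
    have "\<eta> * (8 * B1\<^sup>2 * B3 * (2 - \<beta>)) \<le> sqrt (2 * \<mu> * (1 - \<mu>)) * \<beta>"
      using \<eta>2 den by (simp add: field_simps)
    moreover have "\<eta> * (8 * B1\<^sup>2 * B3) * 1 \<le> \<eta> * (8 * B1\<^sup>2 * B3) * (2 - \<beta>)"
      using pos \<beta> by (intro mult_left_mono) auto
    ultimately have "\<eta> * (8 * B1\<^sup>2 * B3) \<le> sqrt (2 * \<mu> * (1 - \<mu>)) * \<beta>"
      by (simp only: mult.assoc mult_1_right)
    then have "(\<eta> * (8 * B1\<^sup>2 * B3))\<^sup>2 \<le> (sqrt (2 * \<mu> * (1 - \<mu>)) * \<beta>)\<^sup>2"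
      using pos by (intro power_mono) auto
    also have "\<dots> = 2 * \<mu> * (1 - \<mu>) * \<beta>\<^sup>2"
      using \<mu>0 by (simp add: power_mult_distrib)
    finally have e1: "32 * (\<eta>\<^sup>2 * B1^4 * B3\<^sup>2) \<le> \<mu> * (1 - \<mu>) * \<beta>\<^sup>2"
      by (simp add: power_mult_distrib algebra_simps flip: power_mult)
    \<comment> \<open>Trading \<open>\<beta>^2\<close> for \<open>2 * (1 - \<mu>)\<close> supplies a
      second factor \<open>1 - \<mu>\<close>, so that one is left after the division by
      \<open>1 - \<mu>\<close>.\<close>
    have "\<mu> * (1 - \<mu>) * \<beta>\<^sup>2 * \<beta> \<le> 1 * (1 - \<mu>) * (2 * (1 - \<mu>)) * 1"
    proof (intro mult_mono)
      have "\<beta>\<^sup>2 \<le> \<beta>" using \<beta> by (simp add: power2_eq_square mult_left_le)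
      also have "\<beta> \<le> 2 * (1 - \<mu>)" using half by simp
      finally show "\<beta>\<^sup>2 \<le> 2 * (1 - \<mu>)" .
    qed (use \<mu>0 \<beta> in auto)
    with mult_right_mono[OF e1, of \<beta>] \<beta>
    have "32 * (\<eta>\<^sup>2 * B1^4 * B3\<^sup>2) * \<beta> \<le> 1 * (1 - \<mu>) * (2 * (1 - \<mu>)) * 1"
      by (meson less_imp_le order_trans)
    then have "2 * \<beta> * B1^4 * \<eta>\<^sup>2 * B3\<^sup>2 \<le> (1 - \<mu>) / 8 * (1 - \<mu>)"
      by (simp add: algebra_simps)
    then have e2: "2 * \<beta> * B1^4 * \<eta>\<^sup>2 * B3\<^sup>2 / (1 - \<mu>) \<le> (1 - \<mu>) / 8"
      using \<mu>0 by (simp only: pos_divide_le_eq diff_gt_0_iff_gt)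
    have "2 * \<kappa> * \<beta> * B1^4 * \<eta>\<^sup>2 * B3\<^sup>2 / (1 - \<mu>) \<le> \<kappa> * (1 - \<mu>) / 8"
      using mult_left_mono[OF e2, of \<kappa>] \<kappa>0 by (simp add: mult_ac)
    moreover have "\<beta> / 2 * B3\<^sup>2 + 2 * c2 * \<eta>\<^sup>2 * \<beta> * B3\<^sup>2 = \<kappa> * (1 - \<mu>) / 2"
      using \<mu>0 by (simp add: \<kappa>_def D_def field_simps)
    ultimately show ?thesis unfolding c'_def by linarith
  qed
  show ?thesis using \<kappa>0 c0 c'0 A B by blast
qed

text \<open>\<open>a\<close>, \<open>x\<close>, \<open>h\<close> stand for the norms of the
  gradient, the cache error and the surrogate gradient, \<open>p\<close> for the inner product of
  the two pullbacks. Young's inequality for \<open>\<eta> * B1^2 * a\<close> and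
  \<open>B3 * x\<close> absorbs the cross term and produces the terms with
  \<open>\<beta> / 2\<close> in the bounds for \<open>c\<close> and \<open>c'\<close>.\<close>

lemma expected_decrease:
  fixes a x h p :: real
  assumes "0 < \<beta>" "0 \<le> \<eta>" "0 \<le> c2" "0 \<le> \<kappa>" "\<mu> < 1"
    and p: "l * a\<^sup>2 - B1\<^sup>2 * B3 * a * x \<le> p"
    and h: "h\<^sup>2 \<le> 2 * a\<^sup>2 + 2 * B3\<^sup>2 * x\<^sup>2"
    and c: "c \<le> \<beta> * l * \<eta> - \<beta> / 2 * \<eta>\<^sup>2 * B1^4 - 2 * c2 * \<eta>\<^sup>2 * \<beta> - 2 * \<kappa> * \<beta> * B1^4 * \<eta>\<^sup>2 / (1 - \<mu>)"
    and c': "c' \<le> \<kappa> * (1 - \<mu>) - \<beta> / 2 * B3\<^sup>2 - 2 * c2 * \<eta>\<^sup>2 * \<beta> * B3\<^sup>2 - 2 * \<kappa> * \<beta> * B1^4 * \<eta>\<^sup>2 * B3\<^sup>2 / (1 - \<mu>)"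
  shows "\<beta> * (- \<eta> * p + (c2 * \<eta>\<^sup>2 + \<kappa> * (B1^4 * \<eta>\<^sup>2 / (1 - \<mu>))) * h\<^sup>2) - \<kappa> * (1 - \<mu>) * x\<^sup>2
    \<le> - c * a\<^sup>2 - c' * x\<^sup>2"
proof -
  define m where "m = c2 * \<eta>\<^sup>2 + \<kappa> * (B1^4 * \<eta>\<^sup>2 / (1 - \<mu>))"
  have m0: "m \<ge> 0" unfolding m_def using assms by simp
  have "0 \<le> (\<eta> * B1\<^sup>2 * a - B3 * x)\<^sup>2" by simp
  then have "\<eta> * (B1\<^sup>2 * B3 * a * x) \<le> \<eta>\<^sup>2 * B1^4 * a\<^sup>2 / 2 + B3\<^sup>2 * x\<^sup>2 / 2"
    by (simp add: power2_diff power_mult_distrib algebra_simps flip: power_mult)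
  moreover have "\<eta> * (l * a\<^sup>2 - B1\<^sup>2 * B3 * a * x) \<le> \<eta> * p"
    by (rule mult_left_mono[OF p \<open>0 \<le> \<eta>\<close>])
  ultimately have "- \<eta> * p \<le> - \<eta> * l * a\<^sup>2 + \<eta>\<^sup>2 * B1^4 * a\<^sup>2 / 2 + B3\<^sup>2 * x\<^sup>2 / 2"
    by (simp add: algebra_simps)
  moreover have "m * h\<^sup>2 \<le> m * (2 * a\<^sup>2 + 2 * B3\<^sup>2 * x\<^sup>2)" by (rule mult_left_mono[OF h m0])
  ultimately have "- \<eta> * p + m * h\<^sup>2
      \<le> - \<eta> * l * a\<^sup>2 + \<eta>\<^sup>2 * B1^4 * a\<^sup>2 / 2 + B3\<^sup>2 * x\<^sup>2 / 2 + m * (2 * a\<^sup>2 + 2 * B3\<^sup>2 * x\<^sup>2)" by linarith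
  then have main: "\<beta> * (- \<eta> * p + m * h\<^sup>2)
      \<le> \<beta> * (- \<eta> * l * a\<^sup>2 + \<eta>\<^sup>2 * B1^4 * a\<^sup>2 / 2 + B3\<^sup>2 * x\<^sup>2 / 2 + m * (2 * a\<^sup>2 + 2 * B3\<^sup>2 * x\<^sup>2))"
    using \<open>0 < \<beta>\<close> by (intro mult_left_mono) auto
  have m2: "\<beta> * m = c2 * \<eta>\<^sup>2 * \<beta> + \<kappa> * \<beta> * B1^4 * \<eta>\<^sup>2 / (1 - \<mu>)"
    by (simp add: m_def algebra_simps)
  have cc: "c \<le> \<beta> * l * \<eta> - \<beta> / 2 * \<eta>\<^sup>2 * B1^4 - 2 * (\<beta> * m)"
    using c unfolding m2 by (simp add: algebra_simps)
  have cc': "c' \<le> \<kappa> * (1 - \<mu>) - \<beta> / 2 * B3\<^sup>2 - 2 * (\<beta> * m) * B3\<^sup>2"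
    using c' unfolding m2 by (simp add: algebra_simps)
  have "\<beta> * (- \<eta> * l * a\<^sup>2 + \<eta>\<^sup>2 * B1^4 * a\<^sup>2 / 2 + B3\<^sup>2 * x\<^sup>2 / 2 + m * (2 * a\<^sup>2 + 2 * B3\<^sup>2 * x\<^sup>2)) - \<kappa> * (1 - \<mu>) * x\<^sup>2
     = - (\<beta> * l * \<eta> - \<beta> / 2 * \<eta>\<^sup>2 * B1^4 - 2 * (\<beta> * m)) * a\<^sup>2
       - (\<kappa> * (1 - \<mu>) - \<beta> / 2 * B3\<^sup>2 - 2 * (\<beta> * m) * B3\<^sup>2) * x\<^sup>2"
    by (simp add: field_simps)
  also have "\<dots> \<le> - c * a\<^sup>2 - c' * x\<^sup>2"
    using mult_right_mono[OF cc, of "a\<^sup>2"] mult_right_mono[OF cc', of "x\<^sup>2"]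
    unfolding mult_minus_left by simp
  finally show ?thesis using main unfolding m_def by linarith
qed

text \<open>\<open>W^2\<close> is at most \<open>2 r^2 A^2 + 2 \<kappa>^2 E^2\<close>. The first
  term is controlled by \<open>Q\<close>, but the decrease is only linear in \<open>E\<close>;
  bounding one factor by \<open>\<kappa> * E k \<le> W k \<le> W 0\<close> turns the second into a
  multiple of \<open>E\<close>.\<close>

lemma inverse_rate_of_lyapunov:
  fixes W A Q E :: "nat \<Rightarrow> real"
  assumes pos: "c > 0" "c' > 0" "\<kappa> > 0" "r > 0"
    and dec: "\<And>k. W (Suc k) \<le> W k - c * Q k - c' * E k"
    and W: "\<And>k. 0 \<le> W k" "\<And>k. W k \<le> r * A k + \<kappa> * E k" "\<And>k. \<kappa> * E k \<le> W k"
    and Q: "\<And>k. (A k)\<^sup>2 \<le> Q k" and E: "\<And>k. 0 \<le> E k"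
  shows "\<exists>C>0. \<forall>k\<ge>1. W k \<le> C / real k"
proof -
  have Q0: "0 \<le> Q k" for k using Q[of k] zero_le_power2 order_trans by blast
  have "decseq W"
    using dec mult_nonneg_nonneg[OF less_imp_le[OF pos(1)] Q0] mult_nonneg_nonneg[OF less_imp_le[OF pos(2)] E]
    by (intro decseq_SucI) (smt (verit, best))
  then have W0: "W k \<le> W 0" for k by (simp add: decseqD)
  \<comment> \<open>The two entries of the minimum make the gradient and cache parts of
    \<open>p * (W k)^2\<close> fit into \<open>c * Q k\<close> and \<open>c' * E k\<close>; the
    \<open>+ 1\<close> keeps the denominator positive when \<open>W 0 = 0\<close>.\<close>
  define p where "p = min (c / (2 * r\<^sup>2)) (c' / (2 * \<kappa> * (W 0 + 1)))"
  have pp: "p > 0" using pos W(1)[of 0] by (simp add: p_def)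
  have p1: "p * (2 * r\<^sup>2) \<le> c"
    using pos by (simp add: p_def pos_le_divide_eq[symmetric])
  have p2: "p * (2 * \<kappa> * (W 0 + 1)) \<le> c'"
    using pos W(1)[of 0] by (simp add: p_def pos_le_divide_eq[symmetric])
  have "W (Suc k) \<le> W k - p * (W k)\<^sup>2" for k
  proof -
    have "(W k)\<^sup>2 \<le> (r * A k + \<kappa> * E k)\<^sup>2" using W by (intro power_mono)
    also have "\<dots> \<le> 2 * r\<^sup>2 * (A k)\<^sup>2 + 2 * \<kappa> * (\<kappa> * E k) * E k"
      using zero_le_power2[of "r * A k - \<kappa> * E k"] by (simp add: power2_eq_square algebra_simps)
    also have "\<dots> \<le> 2 * r\<^sup>2 * Q k + 2 * \<kappa> * (W 0 + 1) * E k"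
      using Q[of k] E[of k] W(3)[of k] W0[of k] pos by (intro add_mono mult_left_mono mult_right_mono) auto
    finally have "p * (W k)\<^sup>2 \<le> p * (2 * r\<^sup>2 * Q k + 2 * \<kappa> * (W 0 + 1) * E k)"
      using pp by (intro mult_left_mono) auto
    also have "\<dots> = p * (2 * r\<^sup>2) * Q k + p * (2 * \<kappa> * (W 0 + 1)) * E k" by (simp add: algebra_simps)
    also have "\<dots> \<le> c * Q k + c' * E k"
      by (intro add_mono mult_right_mono p1 p2 Q0 E)
    finally show ?thesis using dec[of k] by linarith
  qed
  then have "W k \<le> 1 / p / real k" if "k \<ge> 1" for k
    using inverse_rate_of_quadratic_decrease[of p W k] pp that by simp
  then show ?thesis using pp by (intro exI[of _ "1 / p"]) auto
qed

text \<open>A random variable that is a function of the first \<open>k\<close> batches. As batches are finite sets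
  of a finite type, such a variable takes finitely many values, so it needs no measurability
  assumption.\<close>

definition adapted :: "'w measure \<Rightarrow> (nat \<Rightarrow> 'w \<Rightarrow> 'c) \<Rightarrow> nat \<Rightarrow> ('w \<Rightarrow> 'x) \<Rightarrow> bool" where
  "adapted M B k X \<longleftrightarrow> (\<exists>\<Phi>. \<forall>\<omega>\<in>space M. X \<omega> = \<Phi> (\<lambda>i\<in>{..<k}. B i \<omega>))"

lemma adapted_const: "(\<And>\<omega>. \<omega> \<in> space M \<Longrightarrow> X \<omega> = c) \<Longrightarrow> adapted M B k X"
  unfolding adapted_def by (intro exI[of _ "\<lambda>_. c"]) auto

lemma adapted_compose:
  assumes "adapted M B k X"
  shows "adapted M B k (\<lambda>\<omega>. f (X \<omega>))"
proof -
  obtain \<Phi> where "\<And>\<omega>. \<omega> \<in> space M \<Longrightarrow> X \<omega> = \<Phi> (\<lambda>i\<in>{..<k}. B i \<omega>)"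
    using assms unfolding adapted_def by blast
  then show ?thesis unfolding adapted_def by (intro exI[of _ "\<lambda>h. f (\<Phi> h)"]) simp
qed

lemma adapted_Suc:
  assumes "adapted M B k X" and "\<And>\<omega>. \<omega> \<in> space M \<Longrightarrow> Z \<omega> = f (X \<omega>) (B k \<omega>)"
  shows "adapted M B (Suc k) Z"
proof -
  obtain \<Phi> where \<Phi>: "\<And>\<omega>. \<omega> \<in> space M \<Longrightarrow> X \<omega> = \<Phi> (\<lambda>i\<in>{..<k}. B i \<omega>)"
    using assms(1) unfolding adapted_def by blast
  have "restrict (\<lambda>i\<in>{..<Suc k}. B i \<omega>) {..<k} = (\<lambda>i\<in>{..<k}. B i \<omega>)" for \<omega>
    by (auto simp: restrict_def fun_eq_iff)
  then have "Z \<omega> = f (\<Phi> (restrict (\<lambda>i\<in>{..<Suc k}. B i \<omega>) {..<k})) ((\<lambda>i\<in>{..<Suc k}. B i \<omega>) k)"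
    if "\<omega> \<in> space M" for \<omega> using that assms(2) \<Phi> by simp
  then show ?thesis unfolding adapted_def
    by (intro exI[of _ "\<lambda>h. f (\<Phi> (restrict h {..<k})) (h k)"] ballI)
qed

section \<open>Expectations over independent batches\<close>

context prob_space
begin

lemma measurable_history:
  fixes \<Phi> :: "(nat \<Rightarrow> 'c::finite) \<Rightarrow> real"
  shows "\<Phi> \<in> measurable (PiM {..<k} (\<lambda>_. count_space UNIV)) borel"
  by (subst count_space_PiM_finite) (auto intro: countable_finite)

lemma integrable_adapted:
  fixes X :: "'a \<Rightarrow> real" and B :: "nat \<Rightarrow> 'a \<Rightarrow> 'c::finite"
  assumes "indep_vars (\<lambda>_. count_space UNIV) B UNIV" and "adapted M B k X"
  shows "integrable M X"
proof -
  obtain \<Phi> where \<Phi>: "\<And>\<omega>. \<omega> \<in> space M \<Longrightarrow> X \<omega> = \<Phi> (\<lambda>i\<in>{..<k}. B i \<omega>)"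
    using assms(2) unfolding adapted_def by blast
  have "random_variable (count_space UNIV) (B i)" for i
    using assms(1) unfolding indep_vars_def by auto
  then have "(\<lambda>\<omega>. \<lambda>i\<in>{..<k}. B i \<omega>) \<in> measurable M (PiM {..<k} (\<lambda>_. count_space UNIV))"
    by (intro measurable_restrict) auto
  from measurable_compose[OF this measurable_history[of \<Phi>]]
  have meas: "(\<lambda>\<omega>. \<Phi> (\<lambda>i\<in>{..<k}. B i \<omega>)) \<in> borel_measurable M" .
  have fin: "finite (PiE {..<k} (\<lambda>_. UNIV :: 'c set))" by (intro finite_PiE) auto
  \<comment> \<open>There are finitely many histories, so the sum of all absolute values is a
    constant bound.\<close>
  have "norm (\<Phi> (\<lambda>i\<in>{..<k}. B i \<omega>)) \<le> (\<Sum>h\<in>PiE {..<k} (\<lambda>_. UNIV). norm (\<Phi> h))" for \<omega>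
    by (rule member_le_sum[OF _ _ fin]) (auto simp: PiE_def extensional_def)
  then have "integrable M (\<lambda>\<omega>. \<Phi> (\<lambda>i\<in>{..<k}. B i \<omega>))"
    by (intro integrable_const_bound[OF _ meas]) auto
  then show ?thesis using \<Phi> by (subst Bochner_Integration.integrable_cong[OF refl]) auto
qed

lemma expectation_adapted_times_fresh:
  fixes X :: "'a \<Rightarrow> real" and B :: "nat \<Rightarrow> 'a \<Rightarrow> 'n::finite set"
  assumes ind: "indep_vars (\<lambda>_. count_space UNIV) B UNIV" and "adapted M B k X"
  shows "expectation (\<lambda>\<omega>. of_bool (n \<in> B k \<omega>) * X \<omega>) = prob {\<omega> \<in> space M. n \<in> B k \<omega>} * expectation X"
    and "integrable M (\<lambda>\<omega>. of_bool (n \<in> B k \<omega>) * X \<omega>)"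
proof -
  obtain \<Phi> where \<Phi>: "\<And>\<omega>. \<omega> \<in> space M \<Longrightarrow> X \<omega> = \<Phi> (\<lambda>i\<in>{..<k}. B i \<omega>)"
    using assms(2) unfolding adapted_def by blast
  have rv: "random_variable (count_space UNIV) (B k)"
    using ind unfolding indep_vars_def by auto
  \<comment> \<open>Restrictions of an independent family to the disjoint index sets
    \<open>{k}\<close> and \<open>{..<k}\<close> are independent; hence the single batch is wrapped
    as a function on \<open>{k}\<close>.\<close>
  let ?H = "\<lambda>\<omega>. \<lambda>i\<in>{..<k}. B i \<omega>" and ?S = "\<lambda>\<omega>. \<lambda>i\<in>{k}. B i \<omega>"
  have "indep_var (PiM {k} (\<lambda>_. count_space UNIV)) ?S (PiM {..<k} (\<lambda>_. count_space UNIV)) ?H"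
    by (rule indep_var_restrict[OF ind]) auto
  moreover have "(\<lambda>h. of_bool (n \<in> h k)) \<in> borel_measurable (PiM {k} (\<lambda>_. count_space (UNIV :: 'n set set)))"
    by (subst count_space_PiM_finite) (auto intro: countable_finite)
  ultimately have iv: "indep_var borel ((\<lambda>h. of_bool (n \<in> h k)) \<circ> ?S) borel (\<Phi> \<circ> ?H)"
    by (rule indep_var_compose) (rule measurable_history)
  have S: "((\<lambda>h. of_bool (n \<in> h k)) \<circ> ?S) = (\<lambda>\<omega>. of_bool (n \<in> B k \<omega>) :: real)" by auto
  note iv = iv[unfolded S]
  have "Measurable.pred M (\<lambda>\<omega>. n \<in> B k \<omega>)"
    by (rule measurable_compose[OF rv]) simp
  then have ev: "{\<omega> \<in> space M. n \<in> B k \<omega>} \<in> events" by (simp add: pred_def)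
  have ind_eq: "(of_bool (n \<in> B k \<omega>) :: real) = indicator {\<omega> \<in> space M. n \<in> B k \<omega>} \<omega>"
    if "\<omega> \<in> space M" for \<omega> using that by (auto simp: indicator_def)
  have "integrable M (indicator {\<omega> \<in> space M. n \<in> B k \<omega>} :: 'a \<Rightarrow> real)"
    using ev by (simp add: emeasure_eq_measure)
  then have i1: "integrable M (\<lambda>\<omega>. of_bool (n \<in> B k \<omega>) :: real)"
    by (subst Bochner_Integration.integrable_cong[OF refl, where g = "indicator {\<omega> \<in> space M. n \<in> B k \<omega>}"])
      (simp_all add: ind_eq)
  have "expectation (\<lambda>\<omega>. of_bool (n \<in> B k \<omega>) :: real) = expectation (indicator {\<omega> \<in> space M. n \<in> B k \<omega>})"
    by (rule Bochner_Integration.integral_cong) (simp_all add: ind_eq)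
  then have e1: "expectation (\<lambda>\<omega>. of_bool (n \<in> B k \<omega>) :: real) = prob {\<omega> \<in> space M. n \<in> B k \<omega>}"
    using ev by simp
  have i2: "integrable M (\<Phi> \<circ> ?H)"
    by (rule integrable_adapted[OF ind, of k]) (auto simp: adapted_def)
  have e2: "expectation (\<Phi> \<circ> ?H) = expectation X"
    using \<Phi> by (intro Bochner_Integration.integral_cong) auto
  show "expectation (\<lambda>\<omega>. of_bool (n \<in> B k \<omega>) * X \<omega>) = prob {\<omega> \<in> space M. n \<in> B k \<omega>} * expectation X"
  proof -
    have "expectation (\<lambda>\<omega>. of_bool (n \<in> B k \<omega>) * X \<omega>) = expectation (\<lambda>\<omega>. of_bool (n \<in> B k \<omega>) * (\<Phi> \<circ> ?H) \<omega>)"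
      using \<Phi> by (intro Bochner_Integration.integral_cong) auto
    then show ?thesis using indep_var_lebesgue_integral[OF iv i1 i2] unfolding e1 e2 by simp
  qed
  have "integrable M (\<lambda>\<omega>. of_bool (n \<in> B k \<omega>) * X \<omega>) \<longleftrightarrow> integrable M (\<lambda>\<omega>. of_bool (n \<in> B k \<omega>) * (\<Phi> \<circ> ?H) \<omega>)"
    using \<Phi> by (intro Bochner_Integration.integrable_cong) auto
  then show "integrable M (\<lambda>\<omega>. of_bool (n \<in> B k \<omega>) * X \<omega>)"
    using indep_var_integrable[OF iv i1 i2] by simp
qed

text \<open>Stands in for a conditional expectation. Under the expectation each indicator may be
  replaced by \<open>\<beta>\<close>, as its coefficient depends on the past alone; the result is
  then compared with \<open>v\<close> pointwise.\<close>

lemma expectation_le_of_batch_step: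
  fixes U :: "'a \<Rightarrow> real" and B :: "nat \<Rightarrow> 'a \<Rightarrow> 'n::finite set" and X :: "'a \<Rightarrow> 'x"
  assumes ind: "indep_vars (\<lambda>_. count_space UNIV) B UNIV" and X: "adapted M B k X"
    and prob: "\<And>n. prob {\<omega> \<in> space M. n \<in> B k \<omega>} = \<beta>"
    and U: "integrable M U"
    and step: "AE \<omega> in M. U \<omega> \<le> a (X \<omega>) + (\<Sum>n\<in>UNIV. of_bool (n \<in> B k \<omega>) * f n (X \<omega>))"
    and v: "AE \<omega> in M. a (X \<omega>) + (\<Sum>n\<in>UNIV. \<beta> * f n (X \<omega>)) \<le> v (X \<omega>)"
  shows "expectation U \<le> expectation (\<lambda>\<omega>. v (X \<omega>))"
proof -
  have int: "integrable M (\<lambda>\<omega>. h (X \<omega>))" for h :: "'x \<Rightarrow> real"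
    by (rule integrable_adapted[OF ind adapted_compose[OF X]])
  note fresh = expectation_adapted_times_fresh[OF ind adapted_compose[OF X]]
  have "expectation U \<le> expectation (\<lambda>\<omega>. a (X \<omega>) + (\<Sum>n\<in>UNIV. of_bool (n \<in> B k \<omega>) * f n (X \<omega>)))"
    by (intro integral_mono_AE U Bochner_Integration.integrable_add Bochner_Integration.integrable_sum int fresh(2) step)
  also have "\<dots> = expectation (\<lambda>\<omega>. a (X \<omega>)) + (\<Sum>n\<in>UNIV. expectation (\<lambda>\<omega>. of_bool (n \<in> B k \<omega>) * f n (X \<omega>)))"
    by (subst Bochner_Integration.integral_add, rule int, intro Bochner_Integration.integrable_sum fresh(2),
        subst Bochner_Integration.integral_sum) (auto intro: fresh(2) simp del: of_bool_eq sum_of_bool_mult_eq)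
  also have "\<dots> = expectation (\<lambda>\<omega>. a (X \<omega>) + (\<Sum>n\<in>UNIV. \<beta> * f n (X \<omega>)))"
    by (simp add: fresh(1) prob int)
  also have "\<dots> \<le> expectation (\<lambda>\<omega>. v (X \<omega>))"
    by (intro integral_mono_AE int v Bochner_Integration.integrable_add Bochner_Integration.integrable_sum
        integrable_mult_right)
  finally show ?thesis .
qed

lemma expectation_sq_le:
  fixes X :: "'a \<Rightarrow> real"
  assumes "integrable M X" "integrable M (\<lambda>\<omega>. (X \<omega>)\<^sup>2)"
  shows "(expectation X)\<^sup>2 \<le> expectation (\<lambda>\<omega>. (X \<omega>)\<^sup>2)"
  using variance_eq[OF assms] variance_positive[of X] by simp

end

section \<open>Surrogate error and one step inside the local region\<close>

text \<open>Mean value inequality on the segment from \<open>Z\<close> to \<open>W\<close>, exactly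
  the points where (A6) bounds the derivative. With \<open>G Z Z = grad F Z\<close> it measures the
  gradient error by the cache error.\<close>

lemma surrogate_error:
  fixes G :: "real^'d^'n \<Rightarrow> real^'d^'n \<Rightarrow> real^'d^'n"
  assumes "C1 (\<lambda>W. G W Z)" and
    bound: "\<forall>t\<in>{0..1}. \<forall>\<Delta>. norm (surrogate_deriv G Z (Z + t *\<^sub>R (W - Z)) \<Delta>) \<le> K * norm \<Delta>"
  shows "norm (G W Z - G Z Z) \<le> K * norm (W - Z)"
proof -
  let ?S = "(\<lambda>t. Z + t *\<^sub>R (W - Z)) ` {0..1}"
  have S: "?S = closed_segment Z W"
    unfolding closed_segment_image_interval by (intro image_cong) (auto simp: algebra_simps)
  show ?thesis
  proof (rule differentiable_bound[of ?S "\<lambda>W. G W Z" "surrogate_deriv G Z"])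
    fix x assume "x \<in> ?S"
    then obtain t where t: "t \<in> {0..1}" "x = Z + t *\<^sub>R (W - Z)" by auto
    show "onorm (surrogate_deriv G Z x) \<le> K"
      using bound t by (intro onorm_le) auto
    have "(\<lambda>W. G W Z) differentiable (at x)"
      using assms(1) unfolding C1_def differentiable_def by blast
    then show "((\<lambda>W. G W Z) has_derivative surrogate_deriv G Z x) (at x within ?S)"
      unfolding surrogate_deriv_def frechet_derivative_works by (rule has_derivative_at_withinI)
  qed (auto simp: S)
qed

text \<open>The slack in the scalar inequality is a square over \<open>m * (1 - m)\<close>. With
  \<open>m = \<mu>\<close>, a mean retention of \<open>\<mu>^2\<close> becomes a contraction by
  \<open>\<mu>\<close>.\<close>

lemma norm_add_sq_le_weighted:
  fixes u v :: "'a::real_inner"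
  assumes "0 < m" "m < 1"
  shows "(norm (u + v))\<^sup>2 \<le> (norm u)\<^sup>2 / m + (norm v)\<^sup>2 / (1 - m)"
proof -
  have "(norm u)\<^sup>2 / m + (norm v)\<^sup>2 / (1 - m) - (norm u + norm v)\<^sup>2
      = ((1 - m) * norm u - m * norm v)\<^sup>2 / (m * (1 - m))"
    using assms by (simp add: field_simps power2_eq_square)
  then have "(norm u + norm v)\<^sup>2 \<le> (norm u)\<^sup>2 / m + (norm v)\<^sup>2 / (1 - m)"
    using assms by (smt (verit, best) divide_nonneg_pos mult_pos_pos zero_le_power2)
  then show ?thesis
    using power_mono[OF norm_triangle_ineq norm_ge_zero, of u v 2] by linarith
qed

lemma sum_inner_row_proj:
  assumes "linear T"
  shows "u \<bullet> T (row_proj S W) = (\<Sum>n\<in>UNIV. of_bool (n \<in> S) * (u \<bullet> T (row_proj {n} W)))"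
  by (subst row_proj_eq_sum) (simp add: linear_sum[OF assms] linear_scale[OF assms] inner_sum_right)

locale local_region =
  fixes Y :: "real^'s \<Rightarrow> real^'d^'n" and F :: "real^'d^'n \<Rightarrow> real"
    and \<Omega> :: "(real^'s) set" and V :: "(real^'d^'n) set" and B0 L B1 B2 l :: real
  assumes C2: "C2 Y" and C1: "C1 F" and convex: "convex \<Omega>" and maps: "Y ` \<Omega> \<subseteq> V"
    and pos: "B0 > 0" "L > 0" "B1 > 0" "B2 > 0" "l > 0"
    and grad_bound: "\<And>Z. Z \<in> V \<Longrightarrow> norm (grad F Z) \<le> B0"
    and grad_lipschitz: "\<And>Z Z'. Z \<in> V \<Longrightarrow> Z' \<in> V \<Longrightarrow> norm (grad F Z - grad F Z') \<le> L * norm (Z - Z')"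
    and jacobian_bound: "\<And>\<phi>. \<phi> \<in> \<Omega> \<Longrightarrow> norm (full_jacobian Y \<phi>) \<le> B1"
    and second_deriv_bound: "\<And>\<phi>. \<phi> \<in> \<Omega> \<Longrightarrow> norm (second_deriv Y \<phi>) \<le> B2"
    and gram_bound: "\<And>\<phi>. \<phi> \<in> \<Omega> \<Longrightarrow>
      l \<le> smallest_eigenvalue (full_jacobian Y \<phi> ** transpose (full_jacobian Y \<phi>))"
begin

lemma norm_pullback_le_B1: "\<phi> \<in> \<Omega> \<Longrightarrow> norm (pullback Y \<phi> W) \<le> B1 * norm W"
  by (rule order_trans[OF norm_pullback_le mult_right_mono[OF jacobian_bound norm_ge_zero]])

text \<open>Both bounds are tested on one unit matrix. The comparison lets the step-size condition
  on \<open>\<eta> * c5\<close>, stated with \<open>l\<close>, be used with \<open>B1^2\<close> in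
  the AM-GM estimate.\<close>

lemma gram_bound_le:
  assumes "\<phi> \<in> \<Omega>"
  shows "l \<le> B1\<^sup>2"
proof -
  obtain W :: "real^'d^'n" where W: "norm W = 1" using vector_choose_size[of 1] by auto
  have "l * (norm W)\<^sup>2 \<le> (norm (pullback Y \<phi> W))\<^sup>2"
    by (rule pullback_lower_bound[OF gram_bound[OF assms]])
  also have "\<dots> \<le> (B1 * norm W)\<^sup>2" by (intro power_mono norm_pullback_le_B1[OF assms]) auto
  finally show ?thesis by (simp add: W)
qed

text \<open>Changing the Jacobian costs \<open>B0 * B2\<close>, changing the gradient
  \<open>B1 * L * B1\<close>. The sum is the smoothness constant of the objective in the parameter,
  and \<open>c2\<close> is half of it times \<open>B1^2\<close>.\<close>

lemma lipschitz_pullback_grad: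
  assumes "x \<in> \<Omega>" "y \<in> \<Omega>"
  shows "norm (pullback Y x (grad F (Y x)) - pullback Y y (grad F (Y y))) \<le> (L * B1\<^sup>2 + B0 * B2) * norm (x - y)"
proof -
  have V: "Y x \<in> V" "Y y \<in> V" using assms maps by auto
  let ?gx = "grad F (Y x)" and ?gy = "grad F (Y y)"
  have "pullback Y x ?gx - pullback Y y ?gy
      = flatten ?gx v* (full_jacobian Y x - full_jacobian Y y) + pullback Y y (?gx - ?gy)"
    by (simp add: pullback_def linear_diff[OF linear_flatten] vector_matrix_mult_diff_rdistrib
        vector_matrix_mult_diff_distrib)
  then have "norm (pullback Y x ?gx - pullback Y y ?gy)
      \<le> norm ?gx * norm (full_jacobian Y x - full_jacobian Y y) + B1 * norm (?gx - ?gy)"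
    using norm_vector_matrix_le[of "flatten ?gx"] norm_pullback_le_B1[OF assms(2)]
    by (simp only: norm_flatten) (rule order_trans[OF norm_triangle_ineq add_mono])
  also have "\<dots> \<le> B0 * (B2 * norm (x - y)) + B1 * (L * (B1 * norm (x - y)))"
  proof (intro add_mono mult_mono mult_left_mono)
    show "norm (full_jacobian Y x - full_jacobian Y y) \<le> B2 * norm (x - y)"
      by (rule lipschitz_full_jacobian[OF C2 convex second_deriv_bound assms])
    have "norm (Y x - Y y) \<le> B1 * norm (x - y)"
      by (rule lipschitz_of_jacobian_bound[OF C2 convex jacobian_bound assms])
    then show "norm (?gx - ?gy) \<le> L * (B1 * norm (x - y))"
      using grad_lipschitz[OF V] pos mult_left_mono[of "norm (Y x - Y y)" "B1 * norm (x - y)" L] by linarith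
  qed (use pos grad_bound[OF V(1)] in auto)
  finally show ?thesis by (simp add: power2_eq_square algebra_simps)
qed

lemma objective_step:
  assumes "x \<in> \<Omega>" "x - \<eta> *\<^sub>R pullback Y x W \<in> \<Omega>"
  shows "F (Y (x - \<eta> *\<^sub>R pullback Y x W)) \<le> F (Y x) - \<eta> * (pullback Y x (grad F (Y x)) \<bullet> pullback Y x W)
    + 1/2 * (L * B1\<^sup>2 + B0 * B2) * B1\<^sup>2 * \<eta>\<^sup>2 * (norm W)\<^sup>2"
proof -
  let ?K = "L * B1\<^sup>2 + B0 * B2" and ?h = "pullback Y x W"
  have "F (Y (x - \<eta> *\<^sub>R ?h)) \<le> F (Y x) + pullback Y x (grad F (Y x)) \<bullet> (x - \<eta> *\<^sub>R ?h - x)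
      + ?K / 2 * (norm (x - \<eta> *\<^sub>R ?h - x))\<^sup>2"
    by (rule descent_inequality[where f = "\<lambda>\<phi>. F (Y \<phi>)", OF convex assms GDERIV_comp_pullback[OF C2 C1]])
      (rule lipschitz_pullback_grad[OF _ assms(1)])
  moreover have "?K / 2 * \<eta>\<^sup>2 * (norm ?h)\<^sup>2 \<le> ?K / 2 * \<eta>\<^sup>2 * (B1 * norm W)\<^sup>2"
    using pos by (intro mult_left_mono power_mono norm_pullback_le_B1[OF assms(1)]) auto
  ultimately show ?thesis by (simp add: power_mult_distrib mult_ac)
qed

text \<open>Sampled rows are fresh and contribute nothing; the others carry their old error plus the
  drift of \<open>Y\<close>. One factor \<open>B1\<close> bounds the parameter step by
  \<open>W\<close>, another the drift by the step, and squaring gives \<open>B1^4\<close>.\<close>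

lemma cache_step:
  assumes "x \<in> \<Omega>" "x' \<in> \<Omega>" and x': "x' = x - \<eta> *\<^sub>R pullback Y x W" and m: "0 < m" "m < 1"
  shows "(norm ((\<chi> n. if n \<in> S then Y x' $ n else Z $ n) - Y x'))\<^sup>2
    \<le> (norm (row_proj (- S) (Z - Y x)))\<^sup>2 / m + B1^4 * \<eta>\<^sup>2 / (1 - m) * (norm W)\<^sup>2"
proof -
  have "(\<chi> n. if n \<in> S then Y x' $ n else Z $ n) - Y x'
      = row_proj (- S) (Z - Y x) + row_proj (- S) (Y x - Y x')"
    by (simp add: vec_eq_iff row_proj_def)
  then have "(norm ((\<chi> n. if n \<in> S then Y x' $ n else Z $ n) - Y x'))\<^sup>2
      \<le> (norm (row_proj (- S) (Z - Y x)))\<^sup>2 / m + (norm (row_proj (- S) (Y x - Y x')))\<^sup>2 / (1 - m)"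
    by (simp only: norm_add_sq_le_weighted[OF m])
  moreover have "(norm (row_proj (- S) (Y x - Y x')))\<^sup>2 / (1 - m) \<le> B1^4 * \<eta>\<^sup>2 / (1 - m) * (norm W)\<^sup>2"
  proof -
    have "(norm (row_proj (- S) (Y x - Y x')))\<^sup>2 \<le> (norm (Y x - Y x'))\<^sup>2"
      unfolding norm_row_proj norm_sq_rows[of "Y x - Y x'"] by (intro sum_mono) auto
    also have "\<dots> \<le> (B1 * (\<bar>\<eta>\<bar> * (B1 * norm W)))\<^sup>2"
    proof (intro power_mono norm_ge_zero)
      have "norm (x - x') \<le> \<bar>\<eta>\<bar> * (B1 * norm W)"
        unfolding x' using norm_pullback_le_B1[OF assms(1)] by (auto intro: mult_left_mono)
      then show "norm (Y x - Y x') \<le> B1 * (\<bar>\<eta>\<bar> * (B1 * norm W))"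
        using lipschitz_of_jacobian_bound[OF C2 convex jacobian_bound assms(1,2)] pos
          mult_left_mono[of "norm (x - x')" "\<bar>\<eta>\<bar> * (B1 * norm W)" B1] by linarith
    qed
    also have "\<dots> = B1^4 * \<eta>\<^sup>2 * (norm W)\<^sup>2" by (simp add: power_mult_distrib flip: power_mult)
    finally show ?thesis using m by (simp add: divide_right_mono)
  qed
  ultimately show ?thesis by linarith
qed

text \<open>The right-hand side is affine in the indicators of the events that a sample belongs to the
  batch \<open>S\<close>, so that only the inclusion probabilities matter for its expectation.\<close>

lemma lyapunov_step:
  assumes "x \<in> \<Omega>" "x' \<in> \<Omega>" and x': "x' = x - \<eta> *\<^sub>R batch_gradient Y G S Z x"
    and Z': "Z' = (\<chi> n. if n \<in> S then Y x' $ n else Z $ n)"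
    and m: "0 < m" "m < 1" and \<kappa>: "0 \<le> \<kappa>"
    and c2: "c2 = 1/2 * (L * B1\<^sup>2 + B0 * B2) * B1\<^sup>2"
  shows "F (Y x') + \<kappa> * (norm (Z' - Y x'))\<^sup>2 \<le> F (Y x) + \<kappa> * (norm (Z - Y x))\<^sup>2 / m
    + (\<Sum>n\<in>UNIV. of_bool (n \<in> S) *
        (- \<eta> * (pullback Y x (grad F (Y x)) \<bullet> pullback Y x (row_proj {n} (G Z (Y x))))
          + (c2 * \<eta>\<^sup>2 + \<kappa> * (B1^4 * \<eta>\<^sup>2 / (1 - m))) * (norm (G Z (Y x) $ n))\<^sup>2
          - \<kappa> / m * (norm ((Z - Y x) $ n))\<^sup>2))"
proof -
  let ?W = "row_proj S (G Z (Y x))" and ?a = "B1^4 * \<eta>\<^sup>2 / (1 - m)"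
  let ?ip = "\<lambda>n. pullback Y x (grad F (Y x)) \<bullet> pullback Y x (row_proj {n} (G Z (Y x)))"
  have x'': "x' = x - \<eta> *\<^sub>R pullback Y x ?W" by (simp add: x' batch_gradient_eq_pullback)
  have F: "F (Y x') \<le> F (Y x) - \<eta> * (\<Sum>n\<in>UNIV. of_bool (n \<in> S) * ?ip n) + c2 * \<eta>\<^sup>2 * (norm ?W)\<^sup>2"
    using objective_step[OF assms(1), of \<eta> ?W] assms(2)
    unfolding x''[symmetric] sum_inner_row_proj[OF linear_pullback, where S = S] c2 by simp
  \<comment> \<open>The unsampled rows are all rows minus the sampled ones; this rewriting makes the
    cache bound affine in the indicators of \<open>S\<close>.\<close>
  have "(norm (row_proj (- S) (Z - Y x)))\<^sup>2
      = (norm (Z - Y x))\<^sup>2 - (\<Sum>n\<in>UNIV. of_bool (n \<in> S) * (norm ((Z - Y x) $ n))\<^sup>2)"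
    unfolding norm_row_proj norm_sq_rows[of "Z - Y x"] sum_subtractf[symmetric]
    by (intro sum.cong) auto
  then have E: "\<kappa> * (norm (Z' - Y x'))\<^sup>2 \<le> \<kappa> * (((norm (Z - Y x))\<^sup>2
      - (\<Sum>n\<in>UNIV. of_bool (n \<in> S) * (norm ((Z - Y x) $ n))\<^sup>2)) / m + ?a * (norm ?W)\<^sup>2)"
    using cache_step[OF assms(1,2) x'' m, of S Z] \<kappa> unfolding Z' by (intro mult_left_mono) simp_all
  have "(\<Sum>n\<in>UNIV. of_bool (n \<in> S) *
        (- \<eta> * ?ip n + (c2 * \<eta>\<^sup>2 + \<kappa> * ?a) * (norm (G Z (Y x) $ n))\<^sup>2 - \<kappa> / m * (norm ((Z - Y x) $ n))\<^sup>2))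
     = - \<eta> * (\<Sum>n\<in>UNIV. of_bool (n \<in> S) * ?ip n) + (c2 * \<eta>\<^sup>2 + \<kappa> * ?a) * (norm ?W)\<^sup>2
       - \<kappa> / m * (\<Sum>n\<in>UNIV. of_bool (n \<in> S) * (norm ((Z - Y x) $ n))\<^sup>2)"
    unfolding norm_row_proj sum_distrib_left sum.distrib[symmetric] sum_subtractf[symmetric]
    by (intro sum.cong) (auto simp: of_bool_def)
  then show ?thesis using F E by (simp add: algebra_simps diff_divide_distrib)
qed

lemma expected_lyapunov_step:
  assumes x: "x \<in> \<Omega>" and err: "norm (G Z (Y x) - grad F (Y x)) \<le> B3 * norm (Z - Y x)"
    and \<beta>: "0 < \<beta>" "\<beta> = 1 - m\<^sup>2" and m: "0 < m" "m < 1" and nonneg: "0 \<le> \<eta>" "0 \<le> c2" "0 \<le> \<kappa>" "0 \<le> B3"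
    and c: "c \<le> \<beta> * l * \<eta> - \<beta> / 2 * \<eta>\<^sup>2 * B1^4 - 2 * c2 * \<eta>\<^sup>2 * \<beta> - 2 * \<kappa> * \<beta> * B1^4 * \<eta>\<^sup>2 / (1 - m)"
    and c': "c' \<le> \<kappa> * (1 - m) - \<beta> / 2 * B3\<^sup>2 - 2 * c2 * \<eta>\<^sup>2 * \<beta> * B3\<^sup>2 - 2 * \<kappa> * \<beta> * B1^4 * \<eta>\<^sup>2 * B3\<^sup>2 / (1 - m)"
  shows "\<kappa> * (norm (Z - Y x))\<^sup>2 / m
    + (\<Sum>n\<in>UNIV. \<beta> *
        (- \<eta> * (pullback Y x (grad F (Y x)) \<bullet> pullback Y x (row_proj {n} (G Z (Y x))))
          + (c2 * \<eta>\<^sup>2 + \<kappa> * (B1^4 * \<eta>\<^sup>2 / (1 - m))) * (norm (G Z (Y x) $ n))\<^sup>2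
          - \<kappa> / m * (norm ((Z - Y x) $ n))\<^sup>2))
    \<le> \<kappa> * (norm (Z - Y x))\<^sup>2 - c * (norm (grad F (Y x)))\<^sup>2 - c' * (norm (Z - Y x))\<^sup>2"
proof -
  let ?g = "grad F (Y x)" and ?h = "G Z (Y x)" and ?e = "norm (Z - Y x)"
  let ?T = "pullback Y x" and ?a = "c2 * \<eta>\<^sup>2 + \<kappa> * (B1^4 * \<eta>\<^sup>2 / (1 - m))"
  have ip: "(\<Sum>n\<in>UNIV. ?T ?g \<bullet> ?T (row_proj {n} ?h)) = ?T ?g \<bullet> ?T ?h"
    using sum_inner_row_proj[OF linear_pullback, of "?T ?g" Y x UNIV ?h] by (simp add: row_proj_UNIV)
  have "(\<Sum>n\<in>UNIV. \<beta> * (- \<eta> * (?T ?g \<bullet> ?T (row_proj {n} ?h)) + ?a * (norm (?h $ n))\<^sup>2 - \<kappa> / m * (norm ((Z - Y x) $ n))\<^sup>2))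
      = \<beta> * (- \<eta> * (?T ?g \<bullet> ?T ?h) + ?a * (norm ?h)\<^sup>2 - \<kappa> / m * ?e\<^sup>2)"
    unfolding ip[symmetric] norm_sq_rows[of ?h] norm_sq_rows[of "Z - Y x"]
    by (simp add: sum_distrib_left[symmetric] sum.distrib sum_subtractf sum_negf
        sum_divide_distrib[symmetric])
  \<comment> \<open>Since \<open>1 - \<beta> = m^2\<close>, the factor
    \<open>1/m - \<beta>/m\<close> equals \<open>m\<close>: the contraction of the cache
    error.\<close>
  moreover have "\<kappa> * ?e\<^sup>2 / m - \<beta> * (\<kappa> / m * ?e\<^sup>2) = \<kappa> * m * ?e\<^sup>2"
    using m by (simp add: \<beta> field_simps power2_eq_square)
  moreover have "\<beta> * (- \<eta> * (?T ?g \<bullet> ?T ?h) + ?a * (norm ?h)\<^sup>2) - \<kappa> * (1 - m) * ?e\<^sup>2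
      \<le> - c * (norm ?g)\<^sup>2 - c' * ?e\<^sup>2"
  proof (rule expected_decrease[OF \<beta>(1) nonneg(1,2,3) m(2) _ _ c c'])
    have "?T ?h = ?T ?g + ?T (?h - ?g)" by (simp add: linear_add[OF linear_pullback, symmetric])
    then have "?T ?g \<bullet> ?T ?h = (norm (?T ?g))\<^sup>2 + ?T ?g \<bullet> ?T (?h - ?g)"
      by (simp add: inner_add_right power2_norm_eq_inner)
    moreover have "l * (norm ?g)\<^sup>2 \<le> (norm (?T ?g))\<^sup>2"
      by (rule pullback_lower_bound[OF gram_bound[OF x]])
    moreover have "\<bar>?T ?g \<bullet> ?T (?h - ?g)\<bar> \<le> B1\<^sup>2 * B3 * norm ?g * ?e"
    proof -
      have "\<bar>?T ?g \<bullet> ?T (?h - ?g)\<bar> \<le> norm (?T ?g) * norm (?T (?h - ?g))"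
        by (rule Cauchy_Schwarz_ineq2)
      also have "\<dots> \<le> (B1 * norm ?g) * (B1 * (B3 * ?e))"
      proof (intro mult_mono norm_pullback_le_B1[OF x])
        show "norm (?T (?h - ?g)) \<le> B1 * (B3 * ?e)"
          using norm_pullback_le_B1[OF x, of "?h - ?g"] mult_left_mono[OF err, of B1] pos by linarith
      qed (use pos in auto)
      finally show ?thesis by (simp add: power2_eq_square mult_ac)
    qed
    ultimately show "l * (norm ?g)\<^sup>2 - B1\<^sup>2 * B3 * norm ?g * ?e \<le> ?T ?g \<bullet> ?T ?h" by linarith
    have "norm ?h \<le> norm ?g + B3 * ?e" using norm_triangle_ineq[of ?g "?h - ?g"] err by simp
    then have "(norm ?h)\<^sup>2 \<le> (norm ?g + B3 * ?e)\<^sup>2" by (intro power_mono) auto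
    also have "\<dots> \<le> 2 * (norm ?g)\<^sup>2 + 2 * B3\<^sup>2 * ?e\<^sup>2"
      using zero_le_power2[of "norm ?g - B3 * ?e"] by (simp add: power2_eq_square algebra_simps)
    finally show "(norm ?h)\<^sup>2 \<le> 2 * (norm ?g)\<^sup>2 + 2 * B3\<^sup>2 * ?e\<^sup>2" .
  qed
  ultimately show ?thesis by (simp add: algebra_simps)
qed

end

section \<open>The convergence rate of the cached surrogate gradient method\<close>

theorem theorem4p9:
  fixes Y :: "real^'s \<Rightarrow> real^'d^'n"
    and F :: "real^'d^'n \<Rightarrow> real"
    and G :: "real^'d^'n \<Rightarrow> real^'d^'n \<Rightarrow> real^'d^'n"
    and M :: "'w measure"
    and B :: "nat \<Rightarrow> 'w \<Rightarrow> 'n set"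
    and \<theta> :: "nat \<Rightarrow> 'w \<Rightarrow> real^'s"
    and cache :: "nat \<Rightarrow> 'w \<Rightarrow> real^'d^'n"
    and \<theta>0 :: "real^'s"
    and \<Omega> :: "(real^'s) set"
    and V :: "(real^'d^'n) set"
    and Ystar :: "real^'d^'n"
    and b :: nat
    and r \<eta> N B0 L B1 B2 lmin B3 \<mu> c2 c4 \<nu> c5 :: real
  assumes N_def: "N = real CARD('n)"
    and Y_C2: "C2 Y"
    and F_C1: "C1 F"
    and G_C1: "\<And>Z. C1 (\<lambda>W. G W Z)"
    and G_diag: "\<And>Z. G Z Z = grad F Z"
    and batch_size: "1 \<le> b" "b < CARD('n)"
    and prob: "prob_space M"
    and B_card: "\<And>k. AE \<omega> in M. card (B k \<omega>) = b"
    and B_indep: "prob_space.indep_vars M (\<lambda>k. count_space UNIV) B UNIV"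
    and B_prob: "\<And>k n. measure M {\<omega> \<in> space M. n \<in> B k \<omega>} = real b / N"
    and theta_0: "\<And>\<omega>. \<omega> \<in> space M \<Longrightarrow> \<theta> 0 \<omega> = \<theta>0"
    and cache_0: "\<And>\<omega>. \<omega> \<in> space M \<Longrightarrow> cache 0 \<omega> = Y \<theta>0"
    and theta_Suc: "\<And>k \<omega>. \<omega> \<in> space M \<Longrightarrow>
          \<theta> (Suc k) \<omega> = \<theta> k \<omega> - \<eta> *\<^sub>R batch_gradient Y G (B k \<omega>) (cache k \<omega>) (\<theta> k \<omega>)"
    and cache_Suc: "\<And>k \<omega>. \<omega> \<in> space M \<Longrightarrow>
          cache (Suc k) \<omega> =
            (\<chi> n. if n \<in> B k \<omega> then Y (\<theta> (Suc k) \<omega>) $ n else cache k \<omega> $ n)"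
    and Omega: "open \<Omega>" "convex \<Omega>"
    and V_ball: "r > 0" "V = ball Ystar r"
    and Y_maps: "Y ` \<Omega> \<subseteq> V"
    and consts_pos: "B0 > 0" "L > 0" "B1 > 0" "B2 > 0" "lmin > 0" "B3 > 0"
    and A1: "\<And>Z. Z \<in> V \<Longrightarrow> norm (grad F Z) \<le> B0"
    and A2: "\<And>Z Z'. Z \<in> V \<Longrightarrow> Z' \<in> V \<Longrightarrow> norm (grad F Z - grad F Z') \<le> L * norm (Z - Z')"
    and A3: "\<And>\<phi>. \<phi> \<in> \<Omega> \<Longrightarrow> norm (full_jacobian Y \<phi>) \<le> B1"
    and A4: "\<And>\<phi>. \<phi> \<in> \<Omega> \<Longrightarrow> norm (second_deriv Y \<phi>) \<le> B2"
    and A5: "\<And>\<phi>. \<phi> \<in> \<Omega> \<Longrightarrow>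
          lmin \<le> smallest_eigenvalue (full_jacobian Y \<phi> ** transpose (full_jacobian Y \<phi>))"
    and A6: "AE \<omega> in M. \<forall>k. \<forall>t\<in>{0..1}. \<forall>\<Delta>.
          norm (surrogate_deriv G (Y (\<theta> k \<omega>))
                  (Y (\<theta> k \<omega>) + t *\<^sub>R (cache k \<omega> - Y (\<theta> k \<omega>))) \<Delta>) \<le> B3 * norm \<Delta>"
    and iterates_in: "AE \<omega> in M. \<forall>k. \<theta> k \<omega> \<in> \<Omega>"
    and F_convex: "convex_on V F"
    and Ystar_min: "\<And>Z. Z \<in> V \<Longrightarrow> F Ystar \<le> F Z"
    and mu_def: "\<mu> = sqrt (1 - real b / N)"
    and c2_def: "c2 = 1/2 * (L * B1^2 + B0 * B2) * B1^2"
    and c4_def: "c4 = 4 * B1^2 * L * (1 + B1^2 * L)"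
    and nu_def: "\<nu> = \<mu> / (1 - c4 * \<eta>)"
    and c5_def: "c5 = 4 * c2 + real b / (2 * N) * B1^4
          + 2 * real b * B1^4 * B3^2 / (N * \<mu> * (1 - \<mu>) * (1 - \<nu>))"
    and eta_pos: "\<eta> > 0"
    and eta_less: "\<eta> < Min {1 / c4 * (real b / (2 * N)),
          sqrt (2 * \<mu> * (1 - \<mu>)) * real b / (8 * B1^2 * B3 * (2 * N - real b)),
          1,
          real b / (c5 * N) * lmin}"
  shows "\<exists>C>0. \<forall>k\<ge>1. (\<integral>\<omega>. F (Y (\<theta> k \<omega>)) \<partial>M) - F Ystar \<le> C / real k"
proof -
  interpret prob_space M by (rule prob)
  interpret local_region Y F \<Omega> V B0 L B1 B2 lmin
    using Y_C2 F_C1 Omega(2) Y_maps consts_pos A1 A2 A3 A4 A5 by unfold_locales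
  have N: "N > 0" "real b < N" using batch_size N_def by auto
  define \<beta> where "\<beta> = real b / N"
  have \<beta>: "0 < \<beta>" "\<beta> < 1" using N batch_size by (auto simp: \<beta>_def)
  have \<mu>: "\<mu> = sqrt (1 - \<beta>)" "0 < \<mu>" "\<mu> < 1" "\<beta> = 1 - \<mu>\<^sup>2"
    using \<beta> by (auto simp: mu_def \<beta>_def)
  have c2_pos: "c2 > 0" using consts_pos by (simp add: c2_def add_pos_pos)
  have c4_pos: "c4 > 0" using consts_pos by (simp add: c4_def add_pos_pos)
  have eta: "\<eta> < 1 / c4 * (real b / (2 * N))"
    "\<eta> < sqrt (2 * \<mu> * (1 - \<mu>)) * real b / (8 * B1^2 * B3 * (2 * N - real b))"
    "\<eta> < real b / (c5 * N) * lmin"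
    using eta_less by simp_all
  have "1 / c4 * (real b / (2 * N)) = \<beta> / 2 / c4" by (simp add: \<beta>_def)
  then have eta1: "c4 * \<eta> < \<beta> / 2"
    using eta(1) c4_pos by (simp only: pos_less_divide_eq mult.commute)
  have b_eq: "real b = \<beta> * N" using N by (simp add: \<beta>_def)
  have eta2: "\<eta> < sqrt (2 * \<mu> * (1 - \<mu>)) * \<beta> / (8 * B1\<^sup>2 * B3 * (2 - \<beta>))"
  proof -
    have "sqrt (2 * \<mu> * (1 - \<mu>)) * real b / (8 * B1^2 * B3 * (2 * N - real b))
        = (sqrt (2 * \<mu> * (1 - \<mu>)) * \<beta>) * N / ((8 * B1\<^sup>2 * B3 * (2 - \<beta>)) * N)"
      unfolding b_eq by (simp add: algebra_simps)
    then show ?thesis using eta(2) N by simp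
  qed
  have eta3: "\<eta> * c5 < \<beta> * lmin"
  \<comment> \<open>Multiplying out requires \<open>c5 > 0\<close>, which rests on
    \<open>\<nu> < 1\<close>, not yet available here; for \<open>c5 \<le> 0\<close> the signs settle
    the claim.\<close>
  proof (cases "c5 > 0")
    case True
    then show ?thesis using eta(3) N by (simp add: \<beta>_def field_simps)
  next
    case False
    then have "\<eta> * c5 \<le> 0" using eta_pos by (simp add: mult_nonneg_nonpos)
    moreover have "0 < \<beta> * lmin" using \<beta> consts_pos by simp
    ultimately show ?thesis by linarith
  qed
  have c5: "c5 = 4 * c2 + \<beta> / 2 * B1^4 + 2 * \<beta> * B1^4 * B3\<^sup>2 / (\<mu> * (1 - \<mu>) * (1 - \<nu>))"
    unfolding c5_def \<beta>_def by (simp add: mult_ac)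

  have in_\<Omega>: "AE \<omega> in M. \<theta> k \<omega> \<in> \<Omega>" for k using iterates_in by (rule AE_mp) simp
  \<comment> \<open>\<open>lmin \<le> B1^2\<close> needs a point of \<open>\<Omega>\<close>; an
    almost sure membership on a probability space provides one.\<close>
  have "\<exists>\<phi>. \<phi> \<in> \<Omega>"
  proof (rule ccontr)
    assume "\<nexists>\<phi>. \<phi> \<in> \<Omega>"
    then have "AE \<omega> in M. False" using in_\<Omega>[of 0] by simp
    then show False by simp
  qed
  then have lmin_le: "lmin \<le> B1\<^sup>2" using gram_bound_le by blast
  obtain \<kappa> c c' where \<kappa>: "\<kappa> > 0" and c: "c > 0" "c' > 0"
    "c \<le> \<beta> * lmin * \<eta> - \<beta> / 2 * \<eta>\<^sup>2 * B1^4 - 2 * c2 * \<eta>\<^sup>2 * \<beta> - 2 * \<kappa> * \<beta> * B1^4 * \<eta>\<^sup>2 / (1 - \<mu>)"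
    "c' \<le> \<kappa> * (1 - \<mu>) - \<beta> / 2 * B3\<^sup>2 - 2 * c2 * \<eta>\<^sup>2 * \<beta> * B3\<^sup>2 - 2 * \<kappa> * \<beta> * B1^4 * \<eta>\<^sup>2 * B3\<^sup>2 / (1 - \<mu>)"
    using lyapunov_weight_exists[OF \<beta> \<mu>(1) consts_pos(3,6) c2_pos c4_pos eta_pos lmin_le nu_def c5 eta1 eta2 eta3]
    by blast

  \<comment> \<open>The two recursions are coupled, so iterate and cache are traced as one
    pair.\<close>
  have adapted: "adapted M B k (\<lambda>\<omega>. (\<theta> k \<omega>, cache k \<omega>))" for k
  proof (induction k)
    case 0
    show ?case by (rule adapted_const[of M _ "(\<theta>0, Y \<theta>0)"]) (simp add: theta_0 cache_0)
  next
    case (Suc k)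
    show ?case
      by (rule adapted_Suc[OF Suc, where f = "\<lambda>(x, Z) S. let x' = x - \<eta> *\<^sub>R batch_gradient Y G S Z x
          in (x', \<chi> n. if n \<in> S then Y x' $ n else Z $ n)"]) (simp add: theta_Suc cache_Suc Let_def cong: if_cong)
  qed
  have int: "integrable M (\<lambda>\<omega>. h (\<theta> k \<omega>, cache k \<omega>))" for h :: "_ \<Rightarrow> real" and k
    by (rule integrable_adapted[OF B_indep adapted_compose[OF adapted]])

  define W where "W k = expectation (\<lambda>\<omega>. F (Y (\<theta> k \<omega>)) + \<kappa> * (norm (cache k \<omega> - Y (\<theta> k \<omega>)))\<^sup>2) - F Ystar" for k
  \<comment> \<open>First and second moments are both kept: the gap is bounded through
    \<open>A\<close>, the decrease is expressed through \<open>Q\<close>, and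
    \<open>(A k)^2 \<le> Q k\<close> joins them.\<close>
  define A where "A k = expectation (\<lambda>\<omega>. norm (grad F (Y (\<theta> k \<omega>))))" for k
  define Q where "Q k = expectation (\<lambda>\<omega>. (norm (grad F (Y (\<theta> k \<omega>))))\<^sup>2)" for k
  define E where "E k = expectation (\<lambda>\<omega>. (norm (cache k \<omega> - Y (\<theta> k \<omega>)))\<^sup>2)" for k
  have intF: "integrable M (\<lambda>\<omega>. F (Y (\<theta> k \<omega>)))" for k
    using int[of "\<lambda>(x, Z). F (Y x)" k] by simp
  have intA: "integrable M (\<lambda>\<omega>. norm (grad F (Y (\<theta> k \<omega>))))" for k
    using int[of "\<lambda>(x, Z). norm (grad F (Y x))" k] by simp
  have intQ: "integrable M (\<lambda>\<omega>. (norm (grad F (Y (\<theta> k \<omega>))))\<^sup>2)" for k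
    using int[of "\<lambda>(x, Z). (norm (grad F (Y x)))\<^sup>2" k] by simp
  have intE: "integrable M (\<lambda>\<omega>. (norm (cache k \<omega> - Y (\<theta> k \<omega>)))\<^sup>2)" for k
    using int[of "\<lambda>(x, Z). (norm (Z - Y x))\<^sup>2" k] by simp
  have W_eq: "W k = expectation (\<lambda>\<omega>. F (Y (\<theta> k \<omega>))) - F Ystar + \<kappa> * E k" for k
    unfolding W_def E_def by (simp add: intF intE)
  have E_nonneg: "0 \<le> E k" for k unfolding E_def by (intro integral_nonneg_AE) auto

  have decrease: "W (Suc k) \<le> W k - c * Q k - c' * E k" for k
  proof -
    define f where "f n X = (case X of (x, Z) \<Rightarrow>
        - \<eta> * (pullback Y x (grad F (Y x)) \<bullet> pullback Y x (row_proj {n} (G Z (Y x))))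
          + (c2 * \<eta>\<^sup>2 + \<kappa> * (B1^4 * \<eta>\<^sup>2 / (1 - \<mu>))) * (norm (G Z (Y x) $ n))\<^sup>2
          - \<kappa> / \<mu> * (norm ((Z - Y x) $ n))\<^sup>2)" for n X
    let ?U = "\<lambda>\<omega>. F (Y (\<theta> (Suc k) \<omega>)) + \<kappa> * (norm (cache (Suc k) \<omega> - Y (\<theta> (Suc k) \<omega>)))\<^sup>2"
    have "expectation ?U \<le> expectation (\<lambda>\<omega>. (\<lambda>(x, Z). F (Y x) + (\<kappa> * (norm (Z - Y x))\<^sup>2
        - c * (norm (grad F (Y x)))\<^sup>2 - c' * (norm (Z - Y x))\<^sup>2)) (\<theta> k \<omega>, cache k \<omega>))"
    proof (rule expectation_le_of_batch_step[OF B_indep adapted, where \<beta> = \<beta> and f = f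
          and a = "\<lambda>(x, Z). F (Y x) + \<kappa> * (norm (Z - Y x))\<^sup>2 / \<mu>"])
      show "prob {\<omega> \<in> space M. n \<in> B k \<omega>} = \<beta>" for n by (simp add: B_prob \<beta>_def)
      show "integrable M ?U" by (intro Bochner_Integration.integrable_add integrable_mult_right intF intE)
      show "AE \<omega> in M. ?U \<omega> \<le> (\<lambda>(x, Z). F (Y x) + \<kappa> * (norm (Z - Y x))\<^sup>2 / \<mu>) (\<theta> k \<omega>, cache k \<omega>)
          + (\<Sum>n\<in>UNIV. of_bool (n \<in> B k \<omega>) * f n (\<theta> k \<omega>, cache k \<omega>))"
        \<comment> \<open>The descent inequality runs along the segment between consecutive
          iterates, so both endpoints must lie in the convex set \<open>\<Omega>\<close>.\<close>
        using in_\<Omega>[of k] in_\<Omega>[of "Suc k"] AE_space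
      proof eventually_elim
        case (elim \<omega>)
        from lyapunov_step[OF elim(1,2) theta_Suc[OF elim(3)] cache_Suc[OF elim(3)] \<mu>(2,3) less_imp_le[OF \<kappa>] c2_def]
        show ?case by (simp add: f_def)
      qed
      show "AE \<omega> in M. (\<lambda>(x, Z). F (Y x) + \<kappa> * (norm (Z - Y x))\<^sup>2 / \<mu>) (\<theta> k \<omega>, cache k \<omega>)
          + (\<Sum>n\<in>UNIV. \<beta> * f n (\<theta> k \<omega>, cache k \<omega>)) \<le> (\<lambda>(x, Z). F (Y x) + (\<kappa> * (norm (Z - Y x))\<^sup>2
        - c * (norm (grad F (Y x)))\<^sup>2 - c' * (norm (Z - Y x))\<^sup>2)) (\<theta> k \<omega>, cache k \<omega>)"
        using in_\<Omega>[of k] A6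
      proof eventually_elim
        case (elim \<omega>)
        have "norm (G (cache k \<omega>) (Y (\<theta> k \<omega>)) - grad F (Y (\<theta> k \<omega>))) \<le> B3 * norm (cache k \<omega> - Y (\<theta> k \<omega>))"
          using surrogate_error[OF G_C1 spec[OF elim(2), of k]] by (simp only: G_diag)
        from expected_lyapunov_step[where G = G and Z = "cache k \<omega>", OF elim(1) this \<beta>(1) \<mu>(4,2,3) less_imp_le[OF eta_pos]
            less_imp_le[OF c2_pos] less_imp_le[OF \<kappa>] less_imp_le[OF consts_pos(6)] c(3,4)]
        show ?case by (simp add: f_def)
      qed
    qed
    also have "\<dots> = W k + F Ystar - c * Q k - c' * E k"
      unfolding W_def Q_def E_def by (simp add: intF intQ intE algebra_simps)
    finally show ?thesis unfolding W_def by simp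
  qed

  have gap_nonneg: "0 \<le> expectation (\<lambda>\<omega>. F (Y (\<theta> k \<omega>))) - F Ystar" for k
  proof -
    have "AE \<omega> in M. F Ystar \<le> F (Y (\<theta> k \<omega>))"
      using in_\<Omega>[of k] by eventually_elim (use Ystar_min Y_maps in blast)
    then have "expectation (\<lambda>_. F Ystar) \<le> expectation (\<lambda>\<omega>. F (Y (\<theta> k \<omega>)))"
      by (intro integral_mono_AE intF) auto
    then show ?thesis by (simp add: prob_space)
  qed
  \<comment> \<open>Here the radius of the ball enters: \<open>Y (\<theta> k \<omega>)\<close> lies
    within \<open>r\<close> of \<open>Ystar\<close>, so the convexity bound becomes a constant times
    the gradient norm.\<close>
  have gap_le: "expectation (\<lambda>\<omega>. F (Y (\<theta> k \<omega>))) - F Ystar \<le> r * A k" for k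
  proof -
    have "AE \<omega> in M. F (Y (\<theta> k \<omega>)) \<le> F Ystar + r * norm (grad F (Y (\<theta> k \<omega>)))"
      using in_\<Omega>[of k]
    proof eventually_elim
      case (elim \<omega>)
      then have inV: "Y (\<theta> k \<omega>) \<in> V" using Y_maps by blast
      then have "norm (Y (\<theta> k \<omega>) - Ystar) \<le> r" by (simp add: V_ball(2) dist_norm norm_minus_commute)
      then have "norm (grad F (Y (\<theta> k \<omega>))) * norm (Y (\<theta> k \<omega>) - Ystar) \<le> norm (grad F (Y (\<theta> k \<omega>))) * r"
        by (rule mult_left_mono) simp
      moreover have "Ystar \<in> V" using V_ball by simp
      ultimately show ?case
        using convex_gradient_bound[OF F_convex inV _ GDERIV_grad[OF F_C1], of Ystar] by (simp add: mult.commute)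
    qed
    then have "expectation (\<lambda>\<omega>. F (Y (\<theta> k \<omega>))) \<le> expectation (\<lambda>\<omega>. F Ystar + r * norm (grad F (Y (\<theta> k \<omega>))))"
      by (intro integral_mono_AE intF Bochner_Integration.integrable_add integrable_mult_right intA) auto
    also have "\<dots> = F Ystar + r * A k" unfolding A_def by (simp add: intA prob_space)
    finally show ?thesis by simp
  qed
  have "\<exists>C>0. \<forall>k\<ge>1. W k \<le> C / real k"
  proof (rule inverse_rate_of_lyapunov[where W = W and A = A and Q = Q and E = E, OF c(1,2) \<kappa> V_ball(1) decrease])
    fix k
    have \<kappa>E: "0 \<le> \<kappa> * E k" using \<kappa> E_nonneg by simp
    then show "0 \<le> W k" unfolding W_eq using gap_nonneg[of k] by linarith
    show "W k \<le> r * A k + \<kappa> * E k" unfolding W_eq using gap_le[of k] by simp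
    show "\<kappa> * E k \<le> W k" unfolding W_eq using gap_nonneg[of k] by simp
    show "(A k)\<^sup>2 \<le> Q k" unfolding A_def Q_def by (rule expectation_sq_le[OF intA intQ])
  qed (rule E_nonneg)
  moreover have "expectation (\<lambda>\<omega>. F (Y (\<theta> k \<omega>))) - F Ystar \<le> W k" for k
    unfolding W_eq using \<kappa> E_nonneg by simp
  ultimately show ?thesis by (meson order_trans)
qed

end
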